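(* Let $\Bbbk$ be a field and let $\mathcal P=\mathcal P(V,R)$ be a binary quadratic operad over $\Bbbk$, where $V$ is the two-dimensional $S_2$-module with basis $e_1,\ e_2=(12)e_1$ and $R$ is an $S_3$-submodule of $\mathcal F_V(3)=\mathrm{Ind}_{S_2}^{S_3}(V\mathbin{\vec\otimes}V)$. Let $$F=\Big\langle\,(\Bbbk\,\mathrm{id}+\Bbbk(13))(V\mathbin{\vec\otimes}V)\cap R\,\Big\rangle_{S_3}$$ be the $S_3$-submodule of $\mathcal F_V(3)$ generated by all elements of $(\Bbbk\,\mathrm{id}+\Bbbk(13))(V\mathbin{\vec\otimes}V)$ whose images in $\mathcal P(3)=\mathcal F_V(3)/R$ are zero. Then $\mathcal P$ admits a nonsymmetric version if and only if $$\dim\big(\mathcal P(V,R)(3)\big)=\dim\big(\mathcal P(V,F)(3)\big).$$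
   Context: **Binary quadratic operads.** For a finite-dimensional $S_2$-module $V$ over a field $\Bbbk$, put $\mathcal F_V(3)=\Bbbk S_3\otimes_{\Bbbk S_2}(V\mathbin{\vec\otimes}V)$; this is the arity-3 component of the free symmetric operad generated by $V$ in arity 2. Here $V\mathbin{\vec\otimes}V$ is the subspace spanned by the compositions $\mu\mathbin{\vec\otimes}\nu=\mu(\nu(x_1,x_2),x_3)$, and $S_3$ acts by permuting variables. For example, if $e_1=x_1x_2$ and $e_2=x_2x_1$, then $e_1\mathbin{\vec\otimes}e_1=(x_1x_2)x_3$, $e_2\mathbin{\vec\otimes}e_2=x_3(x_2x_1)$, $(13)(e_2\mathbin{\vec\otimes}e_2)=x_1(x_2x_3)$. The subspace $(\Bbbk\,\mathrm{id}+\Bbbk(13))(V\mathbin{\vec\otimes}V)$ means $V\mathbin{\vec\otimes}V+(13)(V\mathbin{\vec\otimes}V)$. For an $S_3$-submodule $R\subseteq\mathcal F_V(3)$, $\mathcal P(V,R)$ is the symmetric operad generated by $V$ in arity 2 with defining relations $R$; thus $\mathcal P(V,R)(3)=\mathcal F_V(3)/R$. **White Manin product with $\mathrm{As}$.** $\mathrm{As}$ is the (symmetric) operad of associative algebras. For $\mathcal P=\mathcal P(V,R)$, the white Manin product $\mathrm{As}\circ\mathcal P$ is the binary quadratic operad generated by $\mathrm{As}(2)\otimes V$ (diagonal $S_2$-action) whose space of relations is the kernel of the natural map $\mathcal F_{\mathrm{As}(2)\otimes V}(3)\to \mathrm{As}(3)\otimes\mathcal P(3)$ (induced by composing componentwise).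 If $V$ has basis $e_1=x_1\circ x_2$, $e_2=(12)e_1=x_2\circ x_1$, then $\mathrm{As}(2)\otimes V$ has basis $h_1=x_1\prec x_2:=x_1x_2\otimes (x_1\circ x_2)$, $h_2=(12)h_1=x_2\prec x_1$, $g_1=x_1\succ x_2:=x_1x_2\otimes(x_2\circ x_1)$, $g_2=(12)g_1=x_2\succ x_1$. **Nonsymmetric version.** $\mathcal P$ is said to admit a nonsymmetric version if $\mathcal P$ is recovered from $\mathrm{As}\circ\mathcal P$ by the identification $g_1=h_2$, $g_2=h_1$ (i.e. $x_1\succ x_2=x_2\prec x_1$), that is, if $$(\mathrm{As}\circ\mathcal P)\big/\{g_1-h_2=0,\ g_2-h_1=0\}\cong\mathcal P$$ as operads. *)

theory Defs
  imports
    "Jordan_Normal_Form.VS_Connect"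
    "HOL-Algebra.QuotRing"
    "HOL-Library.Poly_Mapping"
    "HOL-Library.FuncSet"
    "HOL-Combinatorics.Multiset_Permutations"
begin

hide_const (open) Multiset.mult Polynomial.smult Modules.module Modules.module_hom

section \<open>Symmetric operads over a field\<close>

text \<open>
  The structure maps of a symmetric operad \<open>P\<close> in vector spaces over the field \<open>'k\<close>:
  the spaces \<open>P(n)\<close>, the left action of permutations of \<open>{1..n}\<close> on \<open>P(n)\<close>,
  the identity in \<open>P(1)\<close>, and the partial compositions, where
  \<open>pcomp P m n i\<close> maps \<open>P(m) \<times> P(n)\<close> to \<open>P(m + n - 1)\<close> and inserts its second argument into
  the input \<open>i \<in> {1..m}\<close> of the first one.  Homomorphisms, ideals and quotients depend only on
  these maps, so the operad axioms are not part of the record; the operads below are the free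
  ones and quotients of them.
\<close>

record ('k, 'a) operad =
  component :: "nat \<Rightarrow> ('k, 'a) module"
  act :: "nat \<Rightarrow> (nat \<Rightarrow> nat) \<Rightarrow> 'a \<Rightarrow> 'a"
  unit_op :: 'a
  pcomp :: "nat \<Rightarrow> nat \<Rightarrow> nat \<Rightarrow> 'a \<Rightarrow> 'a \<Rightarrow> 'a"

abbreviation ops :: "('k, 'a) operad \<Rightarrow> nat \<Rightarrow> 'a set" where
  "ops P n \<equiv> carrier (component P n)"

abbreviation op_dim :: "('k::field, 'a) operad \<Rightarrow> nat \<Rightarrow> nat" where
  "op_dim P n \<equiv> vectorspace.dim class_ring (component P n)"

definition operad_iso :: "('k::field, 'a) operad \<Rightarrow> ('k, 'b) operad \<Rightarrow> bool" (infix \<open>\<cong>\<^sub>o\<^sub>p\<close> 50) where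
  "P \<cong>\<^sub>o\<^sub>p Q \<longleftrightarrow> (\<exists>\<phi>.
     (\<forall>n. \<phi> n \<in> LinearCombinations.module_hom class_ring (component P n) (component Q n)
          \<and> bij_betw (\<phi> n) (ops P n) (ops Q n)) \<and>
     (\<forall>n \<sigma>. \<forall>x\<in>ops P n. \<sigma> permutes {1..n} \<longrightarrow> \<phi> n (act P n \<sigma> x) = act Q n \<sigma> (\<phi> n x)) \<and>
     \<phi> 1 (unit_op P) = unit_op Q \<and>
     (\<forall>m n. \<forall>i\<in>{1..m}. \<forall>x\<in>ops P m. \<forall>y\<in>ops P n.
        \<phi> (m + n - 1) (pcomp P m n i x y) = pcomp Q m n i (\<phi> m x) (\<phi> n y)))"

definition sn_submodule :: "('k::field, 'a) operad \<Rightarrow> nat \<Rightarrow> 'a set \<Rightarrow> bool" where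
  "sn_submodule P n N \<longleftrightarrow> submodule class_ring N (component P n) \<and>
     (\<forall>\<sigma>. \<forall>x\<in>N. \<sigma> permutes {1..n} \<longrightarrow> act P n \<sigma> x \<in> N)"

definition sn_generated :: "('k::field, 'a) operad \<Rightarrow> nat \<Rightarrow> 'a set \<Rightarrow> 'a set" where
  "sn_generated P n S = \<Inter>{N. sn_submodule P n N \<and> S \<subseteq> N}"

definition operad_ideal :: "('k::field, 'a) operad \<Rightarrow> (nat \<Rightarrow> 'a set) \<Rightarrow> bool" where
  "operad_ideal P I \<longleftrightarrow> (\<forall>n. sn_submodule P n (I n)) \<and>
     (\<forall>m n. \<forall>i\<in>{1..m}. \<forall>x\<in>ops P m. \<forall>y\<in>ops P n.
        x \<in> I m \<or> y \<in> I n \<longrightarrow> pcomp P m n i x y \<in> I (m + n - 1))"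

definition ideal_generated :: "('k::field, 'a) operad \<Rightarrow> (nat \<Rightarrow> 'a set) \<Rightarrow> nat \<Rightarrow> 'a set" where
  "ideal_generated P S n = \<Inter>{I n |I. operad_ideal P I \<and> (\<forall>m. S m \<subseteq> I m)}"

definition quotient_module :: "('k, 'a) module \<Rightarrow> 'a set \<Rightarrow> ('k, 'a set) module" where
  "quotient_module M N =
     \<lparr>carrier = a_rcosets\<^bsub>M\<^esub> N, mult = undefined, one = undefined, zero = N, add = set_add M,
      smult = (\<lambda>c A. \<Union>a\<in>A. N +>\<^bsub>M\<^esub> (c \<odot>\<^bsub>M\<^esub> a))\<rparr>"

definition quotient_operad :: "('k, 'a) operad \<Rightarrow> (nat \<Rightarrow> 'a set) \<Rightarrow> ('k, 'a set) operad" where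
  "quotient_operad P I =
     \<lparr>component = (\<lambda>n. quotient_module (component P n) (I n)),
      act = (\<lambda>n \<sigma> A. \<Union>a\<in>A. I n +>\<^bsub>component P n\<^esub> act P n \<sigma> a),
      unit_op = I 1 +>\<^bsub>component P 1\<^esub> unit_op P,
      pcomp = (\<lambda>m n i A B. \<Union>a\<in>A. \<Union>b\<in>B.
        I (m + n - 1) +>\<^bsub>component P (m + n - 1)\<^esub> pcomp P m n i a b)\<rparr>"


section \<open>Free operads on binary generators\<close>

text \<open>
  Nonassociative monomials in variables \<open>x\<^sub>1, x\<^sub>2, \<dots>\<close> with binary operation symbols from \<open>'g\<close>.
  The multilinear monomials in \<open>x\<^sub>1, \<dots>, x\<^sub>n\<close> form a basis of \<open>\<F>\<^sub>V(n)\<close>, where \<open>V\<close> is the free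
  \<open>S\<^sub>2\<close>-module on \<open>'g\<close>, with basis \<open>g(x\<^sub>1, x\<^sub>2)\<close> and \<open>g(x\<^sub>2, x\<^sub>1) = (12) g(x\<^sub>1, x\<^sub>2)\<close> for \<open>g :: 'g\<close>.
  For \<open>'g = unit\<close>, \<open>V\<close> is the two-dimensional module with basis \<open>e\<^sub>1 = x\<^sub>1 \<circ> x\<^sub>2\<close>, \<open>e\<^sub>2 = (12) e\<^sub>1\<close>.
\<close>

datatype 'g monomial = Var nat | Op 'g "'g monomial" "'g monomial"

primrec leaves :: "'g monomial \<Rightarrow> nat list" where
  "leaves (Var j) = [j]"
| "leaves (Op g s t) = leaves s @ leaves t"

primrec relabel :: "(nat \<Rightarrow> nat) \<Rightarrow> 'g monomial \<Rightarrow> 'g monomial" where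
  "relabel \<sigma> (Var j) = Var (\<sigma> j)"
| "relabel \<sigma> (Op g s t) = Op g (relabel \<sigma> s) (relabel \<sigma> t)"

text \<open>\<open>graft n i t s\<close> is \<open>s \<circ>\<^sub>i t\<close>, where \<open>t\<close> is a monomial in \<open>x\<^sub>1, \<dots>, x\<^sub>n\<close>.\<close>

primrec graft :: "nat \<Rightarrow> nat \<Rightarrow> 'g monomial \<Rightarrow> 'g monomial \<Rightarrow> 'g monomial" where
  "graft n i t (Var j) =
     (if j < i then Var j else if j = i then relabel (\<lambda>l. l + i - 1) t else Var (j + n - 1))"
| "graft n i t (Op g r s) = Op g (graft n i t r) (graft n i t s)"

definition multilinear_monomials :: "nat \<Rightarrow> 'g monomial set" where
  "multilinear_monomials n = {t. leaves t \<in> permutations_of_set {1..n}}"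

definition free_operad :: "('k::field, 'g monomial \<Rightarrow>\<^sub>0 'k) operad" where
  "free_operad =
     \<lparr>component = (\<lambda>n.
        \<lparr>carrier = {f. Poly_Mapping.keys f \<subseteq> multilinear_monomials n},
         mult = undefined, one = undefined, zero = 0, add = (+),
         smult = (\<lambda>c. Poly_Mapping.map ((*) c))\<rparr>),
      act = (\<lambda>n \<sigma> f. \<Sum>t\<in>Poly_Mapping.keys f.
        Poly_Mapping.single (relabel \<sigma> t) (Poly_Mapping.lookup f t)),
      unit_op = Poly_Mapping.single (Var 1) 1,
      pcomp = (\<lambda>m n i f h. \<Sum>s\<in>Poly_Mapping.keys f. \<Sum>t\<in>Poly_Mapping.keys h.
        Poly_Mapping.single (graft n i t s)
          (Poly_Mapping.lookup f s * Poly_Mapping.lookup h t))\<rparr>"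

text \<open>\<open>\<P>(V,R)\<close>, for \<open>V\<close> the free \<open>S\<^sub>2\<close>-module on \<open>'g\<close> and \<open>R \<subseteq> \<F>\<^sub>V(3)\<close>.\<close>

definition quadratic_ideal ::
    "('g monomial \<Rightarrow>\<^sub>0 'k::field) set \<Rightarrow> nat \<Rightarrow> ('g monomial \<Rightarrow>\<^sub>0 'k) set" where
  "quadratic_ideal R = ideal_generated free_operad (\<lambda>n. if n = 3 then R else {})"

definition quadratic_operad ::
    "('g monomial \<Rightarrow>\<^sub>0 'k::field) set \<Rightarrow> ('k, ('g monomial \<Rightarrow>\<^sub>0 'k) set) operad" where
  "quadratic_operad R = quotient_operad free_operad (quadratic_ideal R)"

text \<open>The subspace of \<open>\<F>\<^sub>V(3)\<close> spanned by the compositions \<open>\<mu>(\<nu>(x\<^sub>1, x\<^sub>2), x\<^sub>3)\<close>, \<open>\<mu>, \<nu> \<in> V = \<F>\<^sub>V(2)\<close>.\<close>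

definition V_tensor_V :: "('g monomial \<Rightarrow>\<^sub>0 'k::field) set" where
  "V_tensor_V = LinearCombinations.module.span class_ring (component free_operad 3)
     {pcomp free_operad 2 2 1 \<mu> \<nu> |\<mu> \<nu>. \<mu> \<in> ops free_operad 2 \<and> \<nu> \<in> ops free_operad 2}"

definition id_plus_13_V_tensor_V :: "('g monomial \<Rightarrow>\<^sub>0 'k::field) set" where
  "id_plus_13_V_tensor_V = V_tensor_V <+>\<^bsub>component free_operad 3\<^esub>
     (act free_operad 3 (Transposition.transpose 1 3) ` V_tensor_V)"


section \<open>White Manin product with the associative operad\<close>

text \<open>
  \<open>As(n)\<close> has as basis the associative words \<open>x\<^bsub>w 1\<^esub> \<cdots> x\<^bsub>w n\<^esub>\<close>, given as lists \<open>w\<close> enumerating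
  \<open>{1..n}\<close>.  Hence \<open>As(n) \<otimes> M\<close> is realised as the space of functions from these words to \<open>M\<close>,
  with \<open>w \<otimes> x\<close> the function with value \<open>x\<close> at \<open>w\<close> and \<open>0\<close> elsewhere.
\<close>

definition As_tensor :: "nat \<Rightarrow> ('k, 'a) module \<Rightarrow> ('k, nat list \<Rightarrow> 'a) module" where
  "As_tensor n M =
     \<lparr>carrier = permutations_of_set {1..n} \<rightarrow>\<^sub>E carrier M,
      mult = undefined, one = undefined,
      zero = (\<lambda>w\<in>permutations_of_set {1..n}. \<zero>\<^bsub>M\<^esub>),
      add = (\<lambda>u v. \<lambda>w\<in>permutations_of_set {1..n}. u w \<oplus>\<^bsub>M\<^esub> v w),
      smult = (\<lambda>c u. \<lambda>w\<in>permutations_of_set {1..n}. c \<odot>\<^bsub>M\<^esub> u w)\<rparr>"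

definition pure_tensor :: "nat \<Rightarrow> ('k, 'a) module \<Rightarrow> nat list \<Rightarrow> 'a \<Rightarrow> nat list \<Rightarrow> 'a" where
  "pure_tensor n M w x = (\<lambda>w'\<in>permutations_of_set {1..n}. if w' = w then x else \<zero>\<^bsub>M\<^esub>)"

text \<open>
  If \<open>V\<close> is free over \<open>S\<^sub>2\<close> on \<open>'g\<close>, then \<open>As(2) \<otimes> V\<close> with the diagonal action is free on the
  elements \<open>x\<^sub>1 \<prec> x\<^sub>2 = x\<^sub>1x\<^sub>2 \<otimes> g(x\<^sub>1, x\<^sub>2)\<close> and \<open>x\<^sub>1 \<succ> x\<^sub>2 = x\<^sub>1x\<^sub>2 \<otimes> g(x\<^sub>2, x\<^sub>1)\<close>.
\<close>

datatype 'g white = Prec 'g | Succ 'g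

text \<open>
  Composing componentwise, a monomial \<open>t\<close> in these generators evaluates in the first factor to
  the word \<open>leaves t\<close> and in the second factor to the following monomial.
\<close>

fun V_part :: "'g white monomial \<Rightarrow> 'g monomial" where
  "V_part (Var j) = Var j"
| "V_part (Op (Prec g) s t) = Op g (V_part s) (V_part t)"
| "V_part (Op (Succ g) s t) = Op g (V_part t) (V_part s)"

text \<open>The natural map \<open>\<F>\<^bsub>As(2)\<otimes>V\<^esub>(n) \<rightarrow> As(n) \<otimes> \<P>(n)\<close>, \<open>\<P> = \<P>(V,R)\<close>.\<close>

definition white_map ::
    "('g monomial \<Rightarrow>\<^sub>0 'k::field) set \<Rightarrow> nat \<Rightarrow> ('g white monomial \<Rightarrow>\<^sub>0 'k) \<Rightarrow>
     nat list \<Rightarrow> ('g monomial \<Rightarrow>\<^sub>0 'k) set" where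
  "white_map R n f =
     (let M = component (quadratic_operad R) n; T = As_tensor n M in
      \<Oplus>\<^bsub>T\<^esub> t\<in>Poly_Mapping.keys f. Poly_Mapping.lookup f t \<odot>\<^bsub>T\<^esub>
        pure_tensor n M (leaves t)
          (quadratic_ideal R n +>\<^bsub>component free_operad n\<^esub> Poly_Mapping.single (V_part t) 1))"

definition white_relations ::
    "('g monomial \<Rightarrow>\<^sub>0 'k::field) set \<Rightarrow> ('g white monomial \<Rightarrow>\<^sub>0 'k) set" where
  "white_relations R =
     {f \<in> ops free_operad 3.
        white_map R 3 f = \<zero>\<^bsub>As_tensor 3 (component (quadratic_operad R) 3)\<^esub>}"

definition As_white_product ::
    "('g monomial \<Rightarrow>\<^sub>0 'k::field) set \<Rightarrow> ('k, ('g white monomial \<Rightarrow>\<^sub>0 'k) set) operad" where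
  "As_white_product R = quadratic_operad (white_relations R)"


section \<open>Nonsymmetric versions\<close>

text \<open>The elements \<open>x\<^sub>1 \<succ> x\<^sub>2 - x\<^sub>2 \<prec> x\<^sub>1\<close> and \<open>x\<^sub>2 \<succ> x\<^sub>1 - x\<^sub>1 \<prec> x\<^sub>2\<close> of \<open>\<F>\<^bsub>As(2)\<otimes>V\<^esub>(2)\<close>.\<close>

definition nonsym_identifications :: "('g white monomial \<Rightarrow>\<^sub>0 'k::field) set" where
  "nonsym_identifications =
     (\<Union>g. {Poly_Mapping.single (Op (Succ g) (Var 1) (Var 2)) 1
             - Poly_Mapping.single (Op (Prec g) (Var 2) (Var 1)) 1,
            Poly_Mapping.single (Op (Succ g) (Var 2) (Var 1)) 1
             - Poly_Mapping.single (Op (Prec g) (Var 1) (Var 2)) 1})"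

definition nonsym_ideal ::
    "('g monomial \<Rightarrow>\<^sub>0 'k::field) set \<Rightarrow> nat \<Rightarrow> ('g white monomial \<Rightarrow>\<^sub>0 'k) set set" where
  "nonsym_ideal R = ideal_generated (As_white_product R)
     (\<lambda>n. if n = 2
       then (\<lambda>x. quadratic_ideal (white_relations R) 2 +>\<^bsub>component free_operad 2\<^esub> x)
              ` nonsym_identifications
       else {})"

definition admits_nonsymmetric_version :: "('g monomial \<Rightarrow>\<^sub>0 'k::field) set \<Rightarrow> bool" where
  "admits_nonsymmetric_version R \<longleftrightarrow>
     quotient_operad (As_white_product R) (nonsym_ideal R) \<cong>\<^sub>o\<^sub>p quadratic_operad R"

end

theory Submission
  imports Defs
begin

text \<open>
  Sending \<open>x \<prec> y\<close> to \<open>x \<circ> y\<close> and \<open>x \<succ> y\<close> to \<open>y \<circ> x\<close> (on monomials, \<open>V_part\<close>) is a morphism from the free operad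
  on \<open>As(2) \<otimes> V\<close> onto the free operad on \<open>V\<close>; its kernel is the ideal of the identifications
  \<open>x \<succ> y = y \<prec> x\<close>, and \<open>\<circ> \<mapsto> \<prec>\<close> is a section.  A relation of \<open>As \<circ> \<P>\<close> splits into relations of \<open>\<P>\<close>
  supported on the monomials evaluating to a single associative word.  For the word \<open>x\<^sub>1x\<^sub>2x\<^sub>3\<close> these
  monomials span \<open>V \<otimes> V + (13)(V \<otimes> V)\<close>, and the other words are permutations of it, so the relations of
  \<open>As \<circ> \<P>\<close> map onto generators of \<open>F\<close>.  Hence the quotient of \<open>As \<circ> \<P>\<close> by the identifications is always
  \<open>\<P>(V,F)\<close>.  Since \<open>F \<subseteq> R\<close>, this is isomorphic to \<open>\<P>(V,R)\<close> iff the dimensions in arity 3 agree.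
\<close>

text \<open>Words are linearly independent in As(3), so a relation of the white product is tested on
  each word separately. A relation of P(V,R) that mixes monomials with no word in common is lost
  unless it follows from relations supported on single words; this is why F can be smaller than R.
  The transposition (13) reflects the two bracketings of one word: \<open>(x1 x2) x3\<close>, with
  \<open>\<prec>\<close> or \<open>\<succ>\<close> at each node, gives the products of x3 with a
  product of x1 and x2, and \<open>x1 (x2 x3)\<close> gives the same shapes with 1 and 3 exchanged.
  Nothing ties an assumed isomorphism with P(V,R) to the canonical maps, so one direction compares
  dimensions only. In the other, the canonical surjection from P(V,F)(3) to P(V,R)(3) is injective
  by finite dimension. This yields F = R as sets, hence an isomorphism in every arity and not only
  in arity 3. Generated ideals are handled through preimages: the preimage of an ideal under a
  homomorphism is an ideal, so inclusions are checked on generators alone.\<close>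

declare One_nat_def [simp del]


section \<open>Quotient modules\<close>

text \<open>Scalar multiplication, action and composition on quotients are unions over
  representatives. Once the value is independent of the representative, the union collapses to one
  coset; the element \<open>x\<close> excludes the empty union.\<close>

lemma UN_eq_const:
  assumes "x \<in> A" "\<And>y. y \<in> A \<Longrightarrow> f y = c"
  shows "(\<Union>y\<in>A. f y) = c"
  using assms by auto

text \<open>Negatives come from the scalar -1. As an additive subgroup, a submodule has the coset
  calculus of abelian groups at its disposal.\<close>

lemma submodule_imp_abelian_subgroup:
  fixes M :: "('k::field, 'a) module"
  assumes "LinearCombinations.submodule class_ring N M"
  shows "abelian_subgroup N M"
proof -
  interpret N: LinearCombinations.submodule class_ring N M by (fact assms)
  interpret M: Module.module class_ring M by (fact N.module)
  have "\<ominus>\<^bsub>M\<^esub> x \<in> N" if "x \<in> N" for x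
  proof -
    have "- 1 \<odot>\<^bsub>M\<^esub> x = \<ominus>\<^bsub>M\<^esub> x"
      using M.smult_minus_1[of x] that N.subset by (auto simp: class_ring_simps)
    thus ?thesis
      using N.smult_closed[of "- 1" x] that by simp
  qed
  hence "subgroup N (add_monoid M)"
    using N.subset N.zero_closed by (intro M.add.subgroupI) (auto simp: a_inv_def[symmetric] intro: N.zero_closed)
  thus ?thesis
    by (intro abelian_subgroupI3 additive_subgroup.intro M.abelian_group_axioms)
qed

lemma a_r_cosetE:
  assumes "y \<in> N +>\<^bsub>M\<^esub> x"
  obtains h where "h \<in> N" "y = h \<oplus>\<^bsub>M\<^esub> x"
  using assms by (auto simp: a_r_coset_def')

lemma abelian_subgroup_coset_absorb:
  assumes "abelian_subgroup N M" "h \<in> N" "x \<in> carrier M"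
  shows "N +>\<^bsub>M\<^esub> (h \<oplus>\<^bsub>M\<^esub> x) = N +>\<^bsub>M\<^esub> x"
proof -
  interpret abelian_subgroup N M by (fact assms)
  show ?thesis
    using assms a_subgroup by (intro a_repr_independence[symmetric]) (auto simp: a_r_coset_def')
qed

lemma abelian_subgroup_coset_eq_iff:
  assumes "abelian_subgroup N M" "x \<in> carrier M" "y \<in> carrier M"
  shows "N +>\<^bsub>M\<^esub> x = N +>\<^bsub>M\<^esub> y \<longleftrightarrow> x \<ominus>\<^bsub>M\<^esub> y \<in> N"
proof -
  interpret abelian_subgroup N M by (fact assms)
  show ?thesis
  proof
    assume "N +>\<^bsub>M\<^esub> x = N +>\<^bsub>M\<^esub> y"
    then obtain h where "h \<in> N" "x = h \<oplus>\<^bsub>M\<^esub> y"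
      using a_rcos_self[OF assms(2)] by (auto simp: a_r_coset_def')
    thus "x \<ominus>\<^bsub>M\<^esub> y \<in> N"
      using assms a_subset by (auto simp: minus_eq a_assoc r_neg subset_iff)
  next
    assume "x \<ominus>\<^bsub>M\<^esub> y \<in> N"
    moreover have "x = (x \<ominus>\<^bsub>M\<^esub> y) \<oplus>\<^bsub>M\<^esub> y"
      using assms by (simp add: minus_eq a_assoc l_neg)
    ultimately show "N +>\<^bsub>M\<^esub> x = N +>\<^bsub>M\<^esub> y"
      using abelian_subgroup_coset_absorb[OF assms(1) _ assms(3)] by metis
  qed
qed

lemma abelian_subgroup_coset_eq_self_iff:
  assumes "abelian_subgroup N M" "x \<in> carrier M"
  shows "N +>\<^bsub>M\<^esub> x = N \<longleftrightarrow> x \<in> N"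
proof -
  interpret abelian_subgroup N M by (fact assms)
  show ?thesis
    using a_coset_join1[OF _ assms(2) a_subgroup] a_coset_join2[OF assms(2) a_subgroup] by blast
qed

lemma quotient_module_smult_coset:
  fixes M :: "('k::field, 'a) module"
  assumes "LinearCombinations.submodule class_ring N M" "x \<in> carrier M"
  shows "c \<odot>\<^bsub>quotient_module M N\<^esub> (N +>\<^bsub>M\<^esub> x) = N +>\<^bsub>M\<^esub> (c \<odot>\<^bsub>M\<^esub> x)"
proof -
  interpret N: LinearCombinations.submodule class_ring N M by (fact assms)
  interpret M: Module.module class_ring M by (fact N.module)
  note sg = submodule_imp_abelian_subgroup[OF assms(1)]
  interpret abelian_subgroup N M by (fact sg)
  have "N +>\<^bsub>M\<^esub> (c \<odot>\<^bsub>M\<^esub> y) = N +>\<^bsub>M\<^esub> (c \<odot>\<^bsub>M\<^esub> x)" if y: "y \<in> N +>\<^bsub>M\<^esub> x" for y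
  proof -
    obtain h where h: "h \<in> N" "y = h \<oplus>\<^bsub>M\<^esub> x"
      using y by (rule a_r_cosetE)
    have "c \<odot>\<^bsub>M\<^esub> y = c \<odot>\<^bsub>M\<^esub> h \<oplus>\<^bsub>M\<^esub> c \<odot>\<^bsub>M\<^esub> x"
      unfolding h(2) using h(1) assms(2) N.subset by (intro M.smult_r_distr) auto
    thus ?thesis
      using N.smult_closed[OF _ h(1), of c] M.smult_closed[OF _ assms(2), of c]
      by (simp only: abelian_subgroup_coset_absorb[OF sg] UNIV_I partial_object.simps)
  qed
  hence "(\<Union>y\<in>N +>\<^bsub>M\<^esub> x. N +>\<^bsub>M\<^esub> (c \<odot>\<^bsub>M\<^esub> y)) = N +>\<^bsub>M\<^esub> (c \<odot>\<^bsub>M\<^esub> x)"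
    by (rule UN_eq_const[OF a_rcos_self[OF assms(2)]])
  thus ?thesis
    by (simp add: quotient_module_def)
qed

lemma quotient_module_add_coset:
  assumes "abelian_subgroup N M" "x \<in> carrier M" "y \<in> carrier M"
  shows "(N +>\<^bsub>M\<^esub> x) \<oplus>\<^bsub>quotient_module M N\<^esub> (N +>\<^bsub>M\<^esub> y) = N +>\<^bsub>M\<^esub> (x \<oplus>\<^bsub>M\<^esub> y)"
  using abelian_subgroup.a_rcos_sum[OF assms] by (simp add: quotient_module_def)

lemma carrier_quotient_module:
  "carrier (quotient_module M N) = (\<lambda>x. N +>\<^bsub>M\<^esub> x) ` carrier M"
  by (auto simp: quotient_module_def A_RCOSETS_def')

lemma zero_quotient_module:
  "\<zero>\<^bsub>quotient_module M N\<^esub> = N"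
  by (simp add: quotient_module_def)

lemma module_quotient_module:
  fixes M :: "('k::field, 'a) module"
  assumes "LinearCombinations.submodule class_ring N M"
  shows "module class_ring (quotient_module M N)"
proof -
  interpret N: LinearCombinations.submodule class_ring N M by (fact assms)
  interpret M: Module.module class_ring M by (fact N.module)
  note sg = submodule_imp_abelian_subgroup[OF assms(1)]
  interpret abelian_subgroup N M by (fact sg)
  \<comment> \<open>The zero of the quotient is the set \<open>N\<close>; written as a coset it
    falls under the rules for cosets of elements.\<close>
  have zero: "N = N +>\<^bsub>M\<^esub> \<zero>\<^bsub>M\<^esub>"
    using a_subset by simp
  note simps = carrier_quotient_module zero_quotient_module quotient_module_add_coset[OF sg]
    quotient_module_smult_coset[OF assms]
  have assoc: "(a * b) \<odot>\<^bsub>M\<^esub> x = a \<odot>\<^bsub>M\<^esub> (b \<odot>\<^bsub>M\<^esub> x)"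
    and l_distr: "(a + b) \<odot>\<^bsub>M\<^esub> x = a \<odot>\<^bsub>M\<^esub> x \<oplus>\<^bsub>M\<^esub> b \<odot>\<^bsub>M\<^esub> x"
    and r_distr: "y \<in> carrier M \<Longrightarrow> a \<odot>\<^bsub>M\<^esub> (x \<oplus>\<^bsub>M\<^esub> y) = a \<odot>\<^bsub>M\<^esub> x \<oplus>\<^bsub>M\<^esub> a \<odot>\<^bsub>M\<^esub> y"
    if "x \<in> carrier M" for a b x y
    using M.smult_assoc1[of a b x] M.smult_l_distr[of a b x] M.smult_r_distr[of a x y] that by simp_all
  show ?thesis
  proof (rule module_criteria, goal_cases)
    case 2
    thus ?case by (subst zero_quotient_module, subst zero) (auto simp: carrier_quotient_module)
  next
    case 4
    have "\<exists>y\<in>carrier M. N +>\<^bsub>M\<^esub> (x \<oplus>\<^bsub>M\<^esub> y) = N" if "x \<in> carrier M" for x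
      using that a_subset by (intro bexI[of _ "\<ominus>\<^bsub>M\<^esub> x"]) (auto simp: M.M.r_neg)
    thus ?case by (auto simp: simps)
  next
    case 8
    have "(N +>\<^bsub>M\<^esub> x) \<oplus>\<^bsub>quotient_module M N\<^esub> N = N +>\<^bsub>M\<^esub> x" if "x \<in> carrier M" for x
      using quotient_module_add_coset[OF sg that M.M.zero_closed] that a_subset by simp
    thus ?case by (auto simp: simps)
  next
    case 1
    show ?case by (rule class_cring.cring_axioms)
  next
    case 3
    show ?case by (auto simp: simps)
  next
    case 5
    show ?case by (auto simp: simps)
  next
    case 6
    show ?case by (auto simp: simps M.M.a_comm)
  next
    case 7
    show ?case by (auto simp: simps M.M.a_assoc)
  next
    case 9
    show ?case by (auto simp: simps assoc)
  next
    case 10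
    show ?case using M.smult_one by (auto simp: simps)
  next
    case 11
    show ?case by (auto simp: simps l_distr)
  next
    case 12
    show ?case by (auto simp: simps r_distr)
  qed
qed


section \<open>Operads with biadditive composition\<close>

text \<open>Closure and biadditivity carry the theory of ideals and quotients below: changing a
  representative alters a composite only by composites with a factor in the ideal. Free operads have
  these properties and quotients inherit them, so quotients can be iterated.\<close>

locale additive_operad =
  fixes P :: "('k::field, 'a) operad"
  assumes component_module: "module class_ring (component P n)"
    and act_closed: "\<sigma> permutes {1..n} \<Longrightarrow> x \<in> ops P n \<Longrightarrow> act P n \<sigma> x \<in> ops P n"
    and act_add: "\<sigma> permutes {1..n} \<Longrightarrow> x \<in> ops P n \<Longrightarrow> y \<in> ops P n \<Longrightarrow>
      act P n \<sigma> (x \<oplus>\<^bsub>component P n\<^esub> y) = act P n \<sigma> x \<oplus>\<^bsub>component P n\<^esub> act P n \<sigma> y"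
    and unit_closed: "unit_op P \<in> ops P 1"
    and pcomp_closed: "i \<in> {1..m} \<Longrightarrow> x \<in> ops P m \<Longrightarrow> y \<in> ops P n \<Longrightarrow>
      pcomp P m n i x y \<in> ops P (m + n - 1)"
    and pcomp_add_left: "i \<in> {1..m} \<Longrightarrow> x \<in> ops P m \<Longrightarrow> x' \<in> ops P m \<Longrightarrow> y \<in> ops P n \<Longrightarrow>
      pcomp P m n i (x \<oplus>\<^bsub>component P m\<^esub> x') y =
      pcomp P m n i x y \<oplus>\<^bsub>component P (m + n - 1)\<^esub> pcomp P m n i x' y"
    and pcomp_add_right: "i \<in> {1..m} \<Longrightarrow> x \<in> ops P m \<Longrightarrow> y \<in> ops P n \<Longrightarrow> y' \<in> ops P n \<Longrightarrow>
      pcomp P m n i x (y \<oplus>\<^bsub>component P n\<^esub> y') =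
      pcomp P m n i x y \<oplus>\<^bsub>component P (m + n - 1)\<^esub> pcomp P m n i x y'"
begin

sublocale component: Module.module class_ring "component P n" for n
  by (rule component_module)

end

definition operad_hom :: "('k::field, 'a) operad \<Rightarrow> ('k, 'b) operad \<Rightarrow> (nat \<Rightarrow> 'a \<Rightarrow> 'b) \<Rightarrow> bool" where
  "operad_hom P Q \<phi> \<longleftrightarrow>
     (\<forall>n. \<phi> n \<in> LinearCombinations.module_hom class_ring (component P n) (component Q n)) \<and>
     (\<forall>n \<sigma>. \<forall>x\<in>ops P n. \<sigma> permutes {1..n} \<longrightarrow> \<phi> n (act P n \<sigma> x) = act Q n \<sigma> (\<phi> n x)) \<and>
     \<phi> 1 (unit_op P) = unit_op Q \<and>
     (\<forall>m n. \<forall>i\<in>{1..m}. \<forall>x\<in>ops P m. \<forall>y\<in>ops P n.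
        \<phi> (m + n - 1) (pcomp P m n i x y) = pcomp Q m n i (\<phi> m x) (\<phi> n y))"

lemma operad_iso_iff_bij_hom:
  "P \<cong>\<^sub>o\<^sub>p Q \<longleftrightarrow> (\<exists>\<phi>. operad_hom P Q \<phi> \<and> (\<forall>n. bij_betw (\<phi> n) (ops P n) (ops Q n)))"
  unfolding operad_iso_def operad_hom_def by (intro ex_cong1) blast

lemma operad_homD:
  assumes "operad_hom P Q \<phi>"
  shows "x \<in> ops P n \<Longrightarrow> \<phi> n x \<in> ops Q n"
    and "x \<in> ops P n \<Longrightarrow> y \<in> ops P n \<Longrightarrow>
      \<phi> n (x \<oplus>\<^bsub>component P n\<^esub> y) = \<phi> n x \<oplus>\<^bsub>component Q n\<^esub> \<phi> n y"
    and "x \<in> ops P n \<Longrightarrow> \<phi> n (c \<odot>\<^bsub>component P n\<^esub> x) = c \<odot>\<^bsub>component Q n\<^esub> \<phi> n x"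
    and "x \<in> ops P n \<Longrightarrow> \<sigma> permutes {1..n} \<Longrightarrow> \<phi> n (act P n \<sigma> x) = act Q n \<sigma> (\<phi> n x)"
    and "\<phi> 1 (unit_op P) = unit_op Q"
    and "i \<in> {1..m} \<Longrightarrow> x \<in> ops P m \<Longrightarrow> z \<in> ops P n \<Longrightarrow>
      \<phi> (m + n - 1) (pcomp P m n i x z) = pcomp Q m n i (\<phi> m x) (\<phi> n z)"
  using assms unfolding operad_hom_def LinearCombinations.module_hom_def by (auto simp: Pi_iff)

lemma operad_homI:
  assumes "\<And>n x. x \<in> ops P n \<Longrightarrow> \<phi> n x \<in> ops Q n"
    and "\<And>n x y. x \<in> ops P n \<Longrightarrow> y \<in> ops P n \<Longrightarrow>
      \<phi> n (x \<oplus>\<^bsub>component P n\<^esub> y) = \<phi> n x \<oplus>\<^bsub>component Q n\<^esub> \<phi> n y"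
    and "\<And>n c x. x \<in> ops P n \<Longrightarrow> \<phi> n (c \<odot>\<^bsub>component P n\<^esub> x) = c \<odot>\<^bsub>component Q n\<^esub> \<phi> n x"
    and "\<And>n \<sigma> x. x \<in> ops P n \<Longrightarrow> \<sigma> permutes {1..n} \<Longrightarrow> \<phi> n (act P n \<sigma> x) = act Q n \<sigma> (\<phi> n x)"
    and "\<phi> 1 (unit_op P) = unit_op Q"
    and "\<And>m n i x y. i \<in> {1..m} \<Longrightarrow> x \<in> ops P m \<Longrightarrow> y \<in> ops P n \<Longrightarrow>
      \<phi> (m + n - 1) (pcomp P m n i x y) = pcomp Q m n i (\<phi> m x) (\<phi> n y)"
  shows "operad_hom P Q \<phi>"
  using assms unfolding operad_hom_def LinearCombinations.module_hom_def by (simp add: Pi_iff)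

lemma operad_hom_compose:
  assumes "operad_hom P Q \<phi>" "operad_hom Q S \<psi>"
  shows "operad_hom P S (\<lambda>n x. \<psi> n (\<phi> n x))"
  by (rule operad_homI) (simp_all add: operad_homD[OF assms(1)] operad_homD[OF assms(2)] del: One_nat_def)

lemma operad_hom_mod_hom:
  assumes "operad_hom P Q \<phi>" "additive_operad P" "additive_operad Q"
  shows "mod_hom class_ring (component P n) (component Q n) (\<phi> n)"
  using assms unfolding operad_hom_def mod_hom_def mod_hom_axioms_def
  by (auto intro: additive_operad.component_module)

lemma sn_submoduleI:
  assumes "additive_operad P" "N \<subseteq> ops P n" "\<zero>\<^bsub>component P n\<^esub> \<in> N"
    and "\<And>x y. x \<in> N \<Longrightarrow> y \<in> N \<Longrightarrow> x \<oplus>\<^bsub>component P n\<^esub> y \<in> N"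
    and "\<And>c x. x \<in> N \<Longrightarrow> c \<odot>\<^bsub>component P n\<^esub> x \<in> N"
    and "\<And>\<sigma> x. x \<in> N \<Longrightarrow> \<sigma> permutes {1..n} \<Longrightarrow> act P n \<sigma> x \<in> N"
  shows "sn_submodule P n N"
  unfolding sn_submodule_def LinearCombinations.submodule_def
  using assms additive_operad.component_module by blast

lemma sn_submoduleD:
  assumes "sn_submodule P n N"
  shows "N \<subseteq> ops P n" "\<zero>\<^bsub>component P n\<^esub> \<in> N"
    and "x \<in> N \<Longrightarrow> y \<in> N \<Longrightarrow> x \<oplus>\<^bsub>component P n\<^esub> y \<in> N"
    and "x \<in> N \<Longrightarrow> c \<odot>\<^bsub>component P n\<^esub> x \<in> N"
    and "x \<in> N \<Longrightarrow> \<sigma> permutes {1..n} \<Longrightarrow> act P n \<sigma> x \<in> N"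
    and "LinearCombinations.submodule class_ring N (component P n)"
  using assms unfolding sn_submodule_def LinearCombinations.submodule_def by auto

lemma operad_idealD:
  assumes "operad_ideal P I"
  shows "sn_submodule P n (I n)"
    and "i \<in> {1..m} \<Longrightarrow> x \<in> I m \<Longrightarrow> y \<in> ops P n \<Longrightarrow> pcomp P m n i x y \<in> I (m + n - 1)"
    and "i \<in> {1..m} \<Longrightarrow> x \<in> ops P m \<Longrightarrow> y \<in> I n \<Longrightarrow> pcomp P m n i x y \<in> I (m + n - 1)"
    and "x \<in> I n \<Longrightarrow> x \<in> ops P n"
proof -
  show "sn_submodule P n (I n)" for n
    using assms by (simp add: operad_ideal_def)
  thus *: "x \<in> I n \<Longrightarrow> x \<in> ops P n" for x n
    using sn_submoduleD(1) by blast
  show "i \<in> {1..m} \<Longrightarrow> x \<in> I m \<Longrightarrow> y \<in> ops P n \<Longrightarrow> pcomp P m n i x y \<in> I (m + n - 1)"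
    and "i \<in> {1..m} \<Longrightarrow> x \<in> ops P m \<Longrightarrow> y \<in> I n \<Longrightarrow> pcomp P m n i x y \<in> I (m + n - 1)"
    using assms * unfolding operad_ideal_def by blast+
qed

lemma sn_submodule_vimage:
  assumes hom: "operad_hom P Q \<phi>" "additive_operad P" "additive_operad Q"
    and "sn_submodule Q n N"
  shows "sn_submodule P n {x \<in> ops P n. \<phi> n x \<in> N}"
proof -
  interpret P: additive_operad P by fact
  interpret mod_hom class_ring "component P n" "component Q n" "\<phi> n"
    by (rule operad_hom_mod_hom) fact+
  note N = sn_submoduleD[OF assms(4)] 
  show ?thesis
    by (rule sn_submoduleI)
      (use N in \<open>auto simp: P.additive_operad_axioms operad_homD[OF hom(1)] P.act_closed\<close>)
qed

text \<open>Kernels are the case of the zero ideal. To see that a homomorphism kills a generated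
  ideal, it then suffices to look at the generators. Ideals of a quotient are pulled back to the
  free operad in the same way.\<close>

lemma operad_ideal_vimage:
  assumes hom: "operad_hom P Q \<phi>" "additive_operad P" "additive_operad Q"
    and I: "operad_ideal Q I"
  shows "operad_ideal P (\<lambda>n. {x \<in> ops P n. \<phi> n x \<in> I n})"
  unfolding operad_ideal_def
proof (intro conjI allI ballI impI)
  show "sn_submodule P n {x \<in> ops P n. \<phi> n x \<in> I n}" for n
    using I by (intro sn_submodule_vimage[OF hom]) (simp add: operad_ideal_def)
  show "pcomp P m n i x y \<in> {x \<in> ops P (m + n - 1). \<phi> (m + n - 1) x \<in> I (m + n - 1)}"
    if "i \<in> {1..m}" "x \<in> ops P m" "y \<in> ops P n"
      "x \<in> {x \<in> ops P m. \<phi> m x \<in> I m} \<or> y \<in> {x \<in> ops P n. \<phi> n x \<in> I n}" for m n i x y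
    using that I additive_operad.pcomp_closed[OF hom(2) that(1-3)]
    by (auto simp: operad_homD[OF hom(1)] intro: operad_idealD[OF I])
qed

context additive_operad
begin

lemma act_zero:
  assumes "\<sigma> permutes {1..n}"
  shows "act P n \<sigma> \<zero>\<^bsub>component P n\<^esub> = \<zero>\<^bsub>component P n\<^esub>"
  using act_add[OF assms component.zero_closed component.zero_closed]
    act_closed[OF assms component.zero_closed] by simp

lemma pcomp_zero_left:
  assumes "i \<in> {1..m}" "y \<in> ops P n"
  shows "pcomp P m n i \<zero>\<^bsub>component P m\<^esub> y = \<zero>\<^bsub>component P (m + n - 1)\<^esub>"
  using pcomp_add_left[OF assms(1) component.zero_closed component.zero_closed assms(2)]
    pcomp_closed[OF assms(1) component.zero_closed assms(2)] by simp

lemma pcomp_zero_right: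
  assumes "i \<in> {1..m}" "x \<in> ops P m"
  shows "pcomp P m n i x \<zero>\<^bsub>component P n\<^esub> = \<zero>\<^bsub>component P (m + n - 1)\<^esub>"
  using pcomp_add_right[OF assms component.zero_closed component.zero_closed]
    pcomp_closed[OF assms component.zero_closed] by simp

lemma operad_ideal_zero: "operad_ideal P (\<lambda>n. {\<zero>\<^bsub>component P n\<^esub>})"
  unfolding operad_ideal_def
proof (intro conjI allI ballI impI)
  show "sn_submodule P n {\<zero>\<^bsub>component P n\<^esub>}" for n
    by (rule sn_submoduleI) (auto simp: additive_operad_axioms act_zero)
qed (auto simp: pcomp_zero_left pcomp_zero_right)

lemma operad_ideal_ops: "operad_ideal P (ops P)"
  unfolding operad_ideal_def
proof (intro conjI allI ballI impI)
  show "sn_submodule P n (ops P n)" for n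
    by (rule sn_submoduleI) (auto simp: additive_operad_axioms act_closed)
qed (auto simp: pcomp_closed)

lemma operad_ideal_Inter:
  assumes "\<I> \<noteq> {}" "\<And>I. I \<in> \<I> \<Longrightarrow> operad_ideal P I"
  shows "operad_ideal P (\<lambda>n. \<Inter>I\<in>\<I>. I n)"
  unfolding operad_ideal_def
proof (intro conjI allI ballI impI)
  have *: "sn_submodule P n (I n)" if "I \<in> \<I>" for I n
    using that assms(2) by (simp add: operad_ideal_def)
  show "sn_submodule P n (\<Inter>I\<in>\<I>. I n)" for n
  proof (rule sn_submoduleI)
    \<comment> \<open>The intersection of an empty family would be the whole type; nonemptiness
      keeps it inside \<open>ops P n\<close>.\<close>
    show "(\<Inter>I\<in>\<I>. I n) \<subseteq> ops P n"
      using assms(1) sn_submoduleD(1)[OF *] by blast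
  qed (use sn_submoduleD[OF *] in \<open>auto simp: additive_operad_axioms\<close>)
qed (use assms(2) in \<open>auto simp: operad_ideal_def\<close>)

lemma ideal_generated_eq:
  "ideal_generated P S n = (\<Inter>I\<in>{I. operad_ideal P I \<and> (\<forall>m. S m \<subseteq> I m)}. I n)"
  by (auto simp: ideal_generated_def)

text \<open>The family of ideals above \<open>S\<close> is not empty, because the whole operad
  \<open>ops P\<close> belongs to it.\<close>

lemma ideal_generated_ideal:
  assumes "\<And>m. S m \<subseteq> ops P m"
  shows "operad_ideal P (ideal_generated P S)"
proof -
  have "operad_ideal P (\<lambda>n. \<Inter>I\<in>{I. operad_ideal P I \<and> (\<forall>m. S m \<subseteq> I m)}. I n)"
    using operad_ideal_ops assms by (intro operad_ideal_Inter) auto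
  thus ?thesis
    by (simp flip: ideal_generated_eq)
qed

end

lemma ideal_generated_subset: "S n \<subseteq> ideal_generated P S n"
  by (auto simp: ideal_generated_def)

lemma ideal_generated_least:
  assumes "operad_ideal P I" "\<And>m. S m \<subseteq> I m"
  shows "ideal_generated P S n \<subseteq> I n"
  using assms by (auto simp: ideal_generated_def)

lemma sn_generated_least:
  assumes "sn_submodule P n N" "S \<subseteq> N"
  shows "sn_generated P n S \<subseteq> N"
  using assms by (auto simp: sn_generated_def)

lemma sn_generated_subset: "S \<subseteq> sn_generated P n S"
  by (auto simp: sn_generated_def)

lemma (in additive_operad) sn_generated_submodule:
  assumes "S \<subseteq> ops P n"
  shows "sn_submodule P n (sn_generated P n S)"
proof -
  have "sn_submodule P n (ops P n)"
    using operad_ideal_ops by (simp add: operad_ideal_def)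
  hence "sn_generated P n S \<subseteq> ops P n"
    using assms by (rule sn_generated_least)
  thus ?thesis
    by (intro sn_submoduleI) (auto simp: additive_operad_axioms sn_generated_def intro: sn_submoduleD)
qed


section \<open>Quotient operads\<close>

locale operad_quotient = additive_operad P for P :: "('k::field, 'a) operad" +
  fixes I :: "nat \<Rightarrow> 'a set"
  assumes ideal: "operad_ideal P I"
begin

abbreviation cls :: "nat \<Rightarrow> 'a \<Rightarrow> 'a set" where
  "cls n x \<equiv> I n +>\<^bsub>component P n\<^esub> x"

lemma ideal_submodule: "LinearCombinations.submodule class_ring (I n) (component P n)"
  using operad_idealD(1)[OF ideal] by (rule sn_submoduleD)

lemmas ideal_subgroup = submodule_imp_abelian_subgroup[OF ideal_submodule]
lemmas ideal_ops = operad_idealD(4)[OF ideal]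

lemma cls_self: "x \<in> ops P n \<Longrightarrow> x \<in> cls n x"
  by (rule abelian_subgroup.a_rcos_self[OF ideal_subgroup])

lemma cls_absorb: "h \<in> I n \<Longrightarrow> x \<in> ops P n \<Longrightarrow> cls n (h \<oplus>\<^bsub>component P n\<^esub> x) = cls n x"
  by (rule abelian_subgroup_coset_absorb[OF ideal_subgroup])

lemma cls_eq_iff:
  "x \<in> ops P n \<Longrightarrow> y \<in> ops P n \<Longrightarrow> cls n x = cls n y \<longleftrightarrow> x \<ominus>\<^bsub>component P n\<^esub> y \<in> I n"
  by (rule abelian_subgroup_coset_eq_iff[OF ideal_subgroup])

lemma cls_eq_ideal_iff: "x \<in> ops P n \<Longrightarrow> cls n x = I n \<longleftrightarrow> x \<in> I n"
  by (rule abelian_subgroup_coset_eq_self_iff[OF ideal_subgroup])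

lemma quotient_component:
  "component (quotient_operad P I) n = quotient_module (component P n) (I n)"
  by (simp add: quotient_operad_def)

lemma quotient_ops: "ops (quotient_operad P I) n = cls n ` ops P n"
  by (simp add: quotient_component carrier_quotient_module)

lemma cls_ops: "x \<in> ops P n \<Longrightarrow> cls n x \<in> ops (quotient_operad P I) n"
  by (auto simp: quotient_ops)

lemma cls_add:
  "x \<in> ops P n \<Longrightarrow> y \<in> ops P n \<Longrightarrow>
    cls n x \<oplus>\<^bsub>component (quotient_operad P I) n\<^esub> cls n y = cls n (x \<oplus>\<^bsub>component P n\<^esub> y)"
  by (simp add: quotient_component quotient_module_add_coset[OF ideal_subgroup])

lemma cls_smult:
  "x \<in> ops P n \<Longrightarrow>
    c \<odot>\<^bsub>component (quotient_operad P I) n\<^esub> cls n x = cls n (c \<odot>\<^bsub>component P n\<^esub> x)"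
  by (simp add: quotient_component quotient_module_smult_coset[OF ideal_submodule])

lemma cls_act:
  assumes "x \<in> ops P n" "\<sigma> permutes {1..n}"
  shows "act (quotient_operad P I) n \<sigma> (cls n x) = cls n (act P n \<sigma> x)"
proof -
  have "cls n (act P n \<sigma> y) = cls n (act P n \<sigma> x)" if y: "y \<in> cls n x" for y
  proof -
    obtain h where h: "h \<in> I n" "y = h \<oplus>\<^bsub>component P n\<^esub> x"
      using y by (rule a_r_cosetE)
    show ?thesis
      using h assms sn_submoduleD(5)[OF operad_idealD(1)[OF ideal]]
      by (simp add: act_add act_closed cls_absorb ideal_ops)
  qed
  hence "(\<Union>y\<in>cls n x. cls n (act P n \<sigma> y)) = cls n (act P n \<sigma> x)"
    by (rule UN_eq_const[OF cls_self[OF assms(1)]])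
  thus ?thesis
    by (simp add: quotient_operad_def)
qed

lemma cls_pcomp:
  assumes "x \<in> ops P m" "y \<in> ops P n" "i \<in> {1..m}"
  shows "pcomp (quotient_operad P I) m n i (cls m x) (cls n y) = cls (m + n - 1) (pcomp P m n i x y)"
proof -
  have *: "cls (m + n - 1) (pcomp P m n i x' y') = cls (m + n - 1) (pcomp P m n i x y)"
    if x': "x' \<in> cls m x" and y': "y' \<in> cls n y" for x' y'
  proof -
    obtain h where h: "h \<in> I m" "x' = h \<oplus>\<^bsub>component P m\<^esub> x"
      using x' by (rule a_r_cosetE)
    obtain k where k: "k \<in> I n" "y' = k \<oplus>\<^bsub>component P n\<^esub> y"
      using y' by (rule a_r_cosetE)
    \<comment> \<open>The representatives are changed one argument at a time, so that each
      difference is a composite with exactly one factor known to lie in the ideal.\<close>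
    have "cls (m + n - 1) (pcomp P m n i x' y') = cls (m + n - 1) (pcomp P m n i x y')"
      using h k assms
      by (simp add: pcomp_add_left cls_absorb ideal_ops operad_idealD(2)[OF ideal] pcomp_closed)
    also have "\<dots> = cls (m + n - 1) (pcomp P m n i x y)"
      using h k assms
      by (simp add: pcomp_add_right cls_absorb ideal_ops operad_idealD(3)[OF ideal] pcomp_closed)
    finally show ?thesis .
  qed
  have "(\<Union>y'\<in>cls n y. cls (m + n - 1) (pcomp P m n i x' y')) = cls (m + n - 1) (pcomp P m n i x y)"
    if "x' \<in> cls m x" for x'
    by (rule UN_eq_const[OF cls_self[OF assms(2)]]) (rule *[OF that])
  hence "(\<Union>x'\<in>cls m x. \<Union>y'\<in>cls n y. cls (m + n - 1) (pcomp P m n i x' y')) =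
      cls (m + n - 1) (pcomp P m n i x y)"
    by (rule UN_eq_const[OF cls_self[OF assms(1)]])
  thus ?thesis
    by (simp add: quotient_operad_def)
qed

lemma cls_unit: "cls 1 (unit_op P) = unit_op (quotient_operad P I)"
  by (simp add: quotient_operad_def)

lemma zero_quotient: "\<zero>\<^bsub>component (quotient_operad P I) n\<^esub> = I n"
  by (simp add: quotient_component zero_quotient_module)

lemma additive_quotient_operad: "additive_operad (quotient_operad P I)"
proof (rule additive_operad.intro)
  show "module class_ring (component (quotient_operad P I) n)" for n
    using module_quotient_module[OF ideal_submodule] by (simp add: quotient_component)
  show "unit_op (quotient_operad P I) \<in> ops (quotient_operad P I) 1"
    using cls_ops[OF unit_closed] by (simp only: cls_unit)
qed (auto simp: quotient_ops cls_act cls_add cls_pcomp act_closed act_add pcomp_closed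
    pcomp_add_left pcomp_add_right)

lemma operad_hom_cls: "operad_hom P (quotient_operad P I) cls"
  by (rule operad_homI)
    (simp_all add: cls_act cls_add cls_pcomp cls_smult cls_unit cls_ops)

text \<open>The quotient consists of sets, so the induced map reads off the value of \<open>\<phi>\<close> on any representative.\<close>

definition induced :: "(nat \<Rightarrow> 'a \<Rightarrow> 'b) \<Rightarrow> nat \<Rightarrow> 'a set \<Rightarrow> 'b" where
  "induced \<phi> n A = \<phi> n (SOME x. x \<in> A)"

lemma induced_cls:
  assumes \<phi>: "operad_hom P Q \<phi>" "additive_operad Q"
    and ker: "\<And>n x. x \<in> I n \<Longrightarrow> \<phi> n x = \<zero>\<^bsub>component Q n\<^esub>"
    and x: "x \<in> ops P n"
  shows "induced \<phi> n (cls n x) = \<phi> n x"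
proof -
  interpret Q: additive_operad Q by fact
  have "(SOME y. y \<in> cls n x) \<in> cls n x"
    using cls_self[OF x] by (rule someI)
  then obtain h where h: "h \<in> I n" "(SOME y. y \<in> cls n x) = h \<oplus>\<^bsub>component P n\<^esub> x"
    by (rule a_r_cosetE)
  show ?thesis
    using h x operad_homD(1)[OF \<phi>(1) x]
    by (simp add: induced_def operad_homD(2)[OF \<phi>(1)] ideal_ops ker)
qed

lemma operad_hom_induced:
  assumes \<phi>: "operad_hom P Q \<phi>" "additive_operad Q"
    and ker: "\<And>n x. x \<in> I n \<Longrightarrow> \<phi> n x = \<zero>\<^bsub>component Q n\<^esub>"
  shows "operad_hom (quotient_operad P I) Q (induced \<phi>)"
proof -
  note [simp] = induced_cls[OF assms]
  note hom = operad_homD[OF \<phi>(1)]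
  have unit: "induced \<phi> 1 (unit_op (quotient_operad P I)) = unit_op Q"
    using induced_cls[OF assms unit_closed] by (simp only: hom(5) cls_unit)
  show ?thesis
    by (rule operad_homI)
      (auto simp: quotient_ops hom unit cls_add cls_smult cls_act cls_pcomp act_closed pcomp_closed
       )
qed

text \<open>The first isomorphism theorem for operads: classes with equal image differ by an element
  of the kernel, which is \<open>I\<close>, so the induced map is injective in each arity.\<close>

lemma quotient_operad_iso:
  assumes \<phi>: "operad_hom P Q \<phi>" "additive_operad Q"
    and ker: "\<And>n. I n = {x \<in> ops P n. \<phi> n x = \<zero>\<^bsub>component Q n\<^esub>}"
    and surj: "\<And>n. \<phi> n ` ops P n = ops Q n"
  shows "quotient_operad P I \<cong>\<^sub>o\<^sub>p Q"
proof -
  interpret Q: additive_operad Q by fact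
  have ker': "x \<in> I n \<Longrightarrow> \<phi> n x = \<zero>\<^bsub>component Q n\<^esub>" for n x
    using ker by simp
  note induced = induced_cls[OF \<phi> ker']
  have "bij_betw (induced \<phi> n) (ops (quotient_operad P I) n) (ops Q n)" for n
    unfolding bij_betw_def
  proof
    interpret mod_hom class_ring "component P n" "component Q n" "\<phi> n"
      by (rule operad_hom_mod_hom[OF \<phi>(1) additive_operad_axioms \<phi>(2)])
    show "induced \<phi> n ` ops (quotient_operad P I) n = ops Q n"
      unfolding quotient_ops image_image surj[symmetric] by (rule image_cong) (auto simp: induced)
    show "inj_on (induced \<phi> n) (ops (quotient_operad P I) n)"
    proof (rule inj_onI)
      fix A B assume "A \<in> ops (quotient_operad P I) n" "B \<in> ops (quotient_operad P I) n"
        and eq: "induced \<phi> n A = induced \<phi> n B"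
      then obtain x y where xy: "x \<in> ops P n" "A = cls n x" "y \<in> ops P n" "B = cls n y"
        by (auto simp: quotient_ops)
      have "\<phi> n (x \<ominus>\<^bsub>component P n\<^esub> y) = \<zero>\<^bsub>component Q n\<^esub>"
        using eq xy by (simp add: induced f_minus Q.component.r_neg Q.component.minus_eq operad_homD[OF \<phi>(1)])
      thus "A = B"
        using xy cls_eq_iff[OF xy(1,3)] ker[of n] component.minus_closed by blast
    qed
  qed
  thus ?thesis
    using operad_hom_induced[OF \<phi> ker'] unfolding operad_iso_iff_bij_hom by blast
qed

end

declare One_nat_def [simp]


section \<open>Linear and bilinear extensions\<close>

abbreviation pm_smult :: "'k::field \<Rightarrow> ('a \<Rightarrow>\<^sub>0 'k) \<Rightarrow> 'a \<Rightarrow>\<^sub>0 'k" where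
  "pm_smult c \<equiv> Poly_Mapping.map ((*) c)"

lemma lookup_smult [simp]: "Poly_Mapping.lookup (pm_smult c f) t = c * Poly_Mapping.lookup f t"
  by transfer (auto simp: when_def)

lemma keys_smult_subset: "Poly_Mapping.keys (pm_smult c f) \<subseteq> Poly_Mapping.keys f"
  by (auto simp: in_keys_iff)

text \<open>The action and the composition of the free operad are by definition sums of this and the
  next kind, with basis maps \<open>relabel \<sigma>\<close> and \<open>graft\<close>. Linear
  algebra is thus done once for arbitrary basis maps.\<close>

definition lin_ext :: "('a \<Rightarrow> 'b) \<Rightarrow> ('a \<Rightarrow>\<^sub>0 'k::field) \<Rightarrow> 'b \<Rightarrow>\<^sub>0 'k" where
  "lin_ext m f = (\<Sum>t\<in>Poly_Mapping.keys f. Poly_Mapping.single (m t) (Poly_Mapping.lookup f t))"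

definition bilin_ext ::
    "('a \<Rightarrow> 'b \<Rightarrow> 'c) \<Rightarrow> ('a \<Rightarrow>\<^sub>0 'k::field) \<Rightarrow> ('b \<Rightarrow>\<^sub>0 'k) \<Rightarrow> 'c \<Rightarrow>\<^sub>0 'k" where
  "bilin_ext G f h = (\<Sum>s\<in>Poly_Mapping.keys f. \<Sum>t\<in>Poly_Mapping.keys h.
     Poly_Mapping.single (G s t) (Poly_Mapping.lookup f s * Poly_Mapping.lookup h t))"

text \<open>Coefficients vanish off the support, so the index set may be enlarged. A common index
  set for two arguments turns additivity into a termwise statement.\<close>

lemma lin_ext_superset:
  assumes "finite A" "Poly_Mapping.keys f \<subseteq> A"
  shows "lin_ext m f = (\<Sum>t\<in>A. Poly_Mapping.single (m t) (Poly_Mapping.lookup f t))"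
  unfolding lin_ext_def using assms by (intro sum.mono_neutral_left) (auto simp: in_keys_iff)

lemma bilin_ext_superset:
  assumes "finite A" "Poly_Mapping.keys f \<subseteq> A" "finite B" "Poly_Mapping.keys h \<subseteq> B"
  shows "bilin_ext G f h = (\<Sum>s\<in>A. \<Sum>t\<in>B.
    Poly_Mapping.single (G s t) (Poly_Mapping.lookup f s * Poly_Mapping.lookup h t))"
proof -
  have "(\<Sum>t\<in>Poly_Mapping.keys h.
      Poly_Mapping.single (G s t) (Poly_Mapping.lookup f s * Poly_Mapping.lookup h t)) = (\<Sum>t\<in>B.
      Poly_Mapping.single (G s t) (Poly_Mapping.lookup f s * Poly_Mapping.lookup h t))" for s
    using assms by (intro sum.mono_neutral_left) (auto simp: in_keys_iff)
  thus ?thesis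
    unfolding bilin_ext_def using assms by (simp, intro sum.mono_neutral_left) (auto simp: in_keys_iff)
qed

lemma lin_ext_zero [simp]: "lin_ext m 0 = 0"
  by (simp add: lin_ext_def)

lemma lin_ext_add: "lin_ext m (f + h) = lin_ext m f + lin_ext m h"
proof -
  let ?A = "Poly_Mapping.keys f \<union> Poly_Mapping.keys h"
  show ?thesis
    using Poly_Mapping.keys_add[of f h]
    by (simp add: lin_ext_superset[of ?A] lookup_add single_add sum.distrib)
qed

lemma lin_ext_single [simp]: "lin_ext m (Poly_Mapping.single t c) = Poly_Mapping.single (m t) c"
  by (subst lin_ext_superset[of "{t}"]) auto

lemma lin_ext_smult: "lin_ext m (pm_smult c f) = pm_smult c (lin_ext m f)"
proof -
  have "pm_smult c (lin_ext m f) = (\<Sum>t\<in>Poly_Mapping.keys f. pm_smult c (Poly_Mapping.single (m t) (Poly_Mapping.lookup f t)))"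
    unfolding lin_ext_def
    by (rule sum_comp_morphism[symmetric, unfolded o_def])
      (auto intro!: poly_mapping_eqI simp: lookup_add distrib_left)
  thus ?thesis
    by (simp add: lin_ext_superset[OF _ keys_smult_subset])
qed

lemma lin_ext_uminus: "lin_ext m (- f) = - lin_ext m f"
proof -
  have "lin_ext m (- f) + lin_ext m f = 0"
    by (simp flip: lin_ext_add)
  thus ?thesis
    by (simp add: eq_neg_iff_add_eq_0)
qed

lemma lin_ext_diff: "lin_ext m (f - h) = lin_ext m f - lin_ext m h"
  using lin_ext_add[of m f "- h"] by (simp add: lin_ext_uminus)

lemma lin_ext_sum: "lin_ext m (\<Sum>x\<in>A. f x) = (\<Sum>x\<in>A. lin_ext m (f x))"
  by (rule sum_comp_morphism[symmetric, unfolded o_def]) (simp_all add: lin_ext_add)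

lemma poly_mapping_sum_single:
  fixes f :: "'a \<Rightarrow>\<^sub>0 'k::comm_monoid_add"
  shows "(\<Sum>t\<in>Poly_Mapping.keys f. Poly_Mapping.single t (Poly_Mapping.lookup f t)) = f"
  by (rule poly_mapping_eqI) (simp add: lookup_sum lookup_single when_def in_keys_iff)

lemma lin_ext_lin_ext: "lin_ext m (lin_ext m' f) = lin_ext (\<lambda>t. m (m' t)) f"
  unfolding lin_ext_def[of m' f] lin_ext_sum by (simp add: lin_ext_def[of "\<lambda>t. m (m' t)"])

lemma lin_ext_cong:
  "(\<And>t. t \<in> Poly_Mapping.keys f \<Longrightarrow> m t = m' t) \<Longrightarrow> lin_ext m f = lin_ext m' f"
  by (simp add: lin_ext_def)

lemma lin_ext_ident: "lin_ext (\<lambda>t. t) f = f"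
  by (simp add: lin_ext_def poly_mapping_sum_single)

lemma keys_sum_single_subset: 
  "Poly_Mapping.keys (\<Sum>x\<in>A. Poly_Mapping.single (g x) (c x)) \<subseteq> g ` A"
proof (induction A rule: infinite_finite_induct)
  case (insert x A)
  show ?case
    using insert Poly_Mapping.keys_add[of "Poly_Mapping.single (g x) (c x)" "\<Sum>x\<in>A. Poly_Mapping.single (g x) (c x)"]
    by (auto split: if_splits)
qed auto

lemma keys_lin_ext: "Poly_Mapping.keys (lin_ext m f) \<subseteq> m ` Poly_Mapping.keys f"
  unfolding lin_ext_def by (rule keys_sum_single_subset)

lemma keys_bilin_ext:
  "Poly_Mapping.keys (bilin_ext G f h) \<subseteq> (\<lambda>(s, t). G s t) ` (Poly_Mapping.keys f \<times> Poly_Mapping.keys h)"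
proof -
  have "bilin_ext G f h = (\<Sum>x\<in>Poly_Mapping.keys f \<times> Poly_Mapping.keys h.
      Poly_Mapping.single ((\<lambda>(s, t). G s t) x) ((\<lambda>(s, t). Poly_Mapping.lookup f s * Poly_Mapping.lookup h t) x))"
    by (simp add: bilin_ext_def sum.cartesian_product case_prod_beta)
  thus ?thesis
    by (simp only: keys_sum_single_subset)
qed

lemma bilin_ext_add_left: "bilin_ext G (f + f') h = bilin_ext G f h + bilin_ext G f' h"
proof -
  let ?A = "Poly_Mapping.keys f \<union> Poly_Mapping.keys f'"
  show ?thesis
    using Poly_Mapping.keys_add[of f f']
    by (simp add: bilin_ext_superset[of ?A _ "Poly_Mapping.keys h"] lookup_add single_add sum.distrib distrib_right)
qed

lemma bilin_ext_add_right: "bilin_ext G f (h + h') = bilin_ext G f h + bilin_ext G f h'"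
proof -
  let ?A = "Poly_Mapping.keys h \<union> Poly_Mapping.keys h'"
  show ?thesis
    using Poly_Mapping.keys_add[of h h']
    by (simp add: bilin_ext_superset[of "Poly_Mapping.keys f" _ ?A] lookup_add single_add sum.distrib distrib_left)
qed

lemma bilin_ext_zero [simp]: "bilin_ext G 0 h = 0" "bilin_ext G f 0 = 0"
  by (simp_all add: bilin_ext_def)

lemma bilin_ext_single [simp]:
  "bilin_ext G (Poly_Mapping.single s c) (Poly_Mapping.single t d) = Poly_Mapping.single (G s t) (c * d)"
  by (subst bilin_ext_superset[of "{s}" _ "{t}"]) auto

lemma bilin_ext_sum_left: "bilin_ext G (\<Sum>x\<in>A. f x) h = (\<Sum>x\<in>A. bilin_ext G (f x) h)"
  by (rule sum_comp_morphism[symmetric, unfolded o_def]) (simp_all add: bilin_ext_add_left)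

lemma bilin_ext_sum_right: "bilin_ext G f (\<Sum>x\<in>A. h x) = (\<Sum>x\<in>A. bilin_ext G f (h x))"
  by (rule sum_comp_morphism[symmetric, unfolded o_def]) (simp_all add: bilin_ext_add_right)

text \<open>Compatibility with operadic composition is reduced to basis elements: a map of monomials
  that commutes with grafting extends to a map that commutes with \<open>pcomp\<close>.\<close>

lemma lin_ext_bilin_ext:
  assumes "\<And>s t. s \<in> Poly_Mapping.keys f \<Longrightarrow> t \<in> Poly_Mapping.keys h \<Longrightarrow> m (G s t) = G' (m s) (m t)"
  shows "lin_ext m (bilin_ext G f h) = bilin_ext G' (lin_ext m f) (lin_ext m h)"
  unfolding bilin_ext_def[of G] lin_ext_def[of m f] lin_ext_def[of m h]
    lin_ext_sum bilin_ext_sum_left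
  unfolding bilin_ext_sum_right using assms by simp


section \<open>Free operads\<close>

lemma ops_free: "ops free_operad n = {f. Poly_Mapping.keys f \<subseteq> multilinear_monomials n}"
  and add_free [simp]: "x \<oplus>\<^bsub>component free_operad n\<^esub> y = x + y"
  and zero_free [simp]: "\<zero>\<^bsub>component free_operad n\<^esub> = 0"
  and smult_free [simp]: "c \<odot>\<^bsub>component free_operad n\<^esub> x = pm_smult c x"
  and act_free: "act free_operad n \<sigma> x = lin_ext (relabel \<sigma>) x"
  and unit_free: "unit_op free_operad = Poly_Mapping.single (Var 1) 1"
  and pcomp_free: "pcomp free_operad m n i x y = bilin_ext (\<lambda>s t. graft n i t s) x y"
  by (simp_all add: free_operad_def lin_ext_def bilin_ext_def)

lemma multilinear_monomials_iff:
  "t \<in> multilinear_monomials n \<longleftrightarrow> set (leaves t) = {1..n} \<and> distinct (leaves t)"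
  by (simp add: multilinear_monomials_def permutations_of_set_def)

lemma leaves_nonempty [simp]: "leaves t \<noteq> []"
  by (induction t) auto

lemma leaves_relabel [simp]: "leaves (relabel \<sigma> t) = map \<sigma> (leaves t)"
  by (induction t) auto

lemma relabel_relabel: "relabel \<sigma> (relabel \<tau> t) = relabel (\<lambda>j. \<sigma> (\<tau> j)) t"
  by (induction t) auto

lemma relabel_cong: "(\<And>j. j \<in> set (leaves t) \<Longrightarrow> \<sigma> j = \<tau> j) \<Longrightarrow> relabel \<sigma> t = relabel \<tau> t"
  by (induction t) auto

lemma relabel_ident [simp]: "relabel (\<lambda>j. j) t = t"
  by (induction t) auto

lemma relabel_inverse: "\<sigma> permutes S \<Longrightarrow> relabel (Hilbert_Choice.inv \<sigma>) (relabel \<sigma> t) = t"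
  by (simp add: relabel_relabel permutes_inverses)

lemma relabel_multilinear_bij:
  assumes "bij_betw \<sigma> (set (leaves t)) {1..n}" "distinct (leaves t)"
  shows "relabel \<sigma> t \<in> multilinear_monomials n"
  using assms by (simp add: multilinear_monomials_iff distinct_map bij_betw_def)

lemma relabel_multilinear:
  assumes "t \<in> multilinear_monomials n" "\<sigma> permutes {1..n}"
  shows "relabel \<sigma> t \<in> multilinear_monomials n"
  using assms permutes_image[OF assms(2)] permutes_inj[OF assms(2)]
  by (auto simp: multilinear_monomials_iff distinct_map intro: inj_on_subset)

lemma leaves_graft:
  "leaves (graft n i t s) = concat (map (\<lambda>j. if j < i then [j] else if j = i
     then map (\<lambda>l. l + i - 1) (leaves t) else [j + n - 1]) (leaves s))"
  by (induction s) auto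

text \<open>Every variable of the relabelled tree lies beyond the slot \<open>i\<close>, so
  \<open>t\<close> is never inserted and only the shift by \<open>n - 1\<close> remains.\<close>

lemma graft_relabel_gt:
  assumes "\<And>j. j \<in> set (leaves s) \<Longrightarrow> i < f j"
  shows "graft n i t (relabel f s) = relabel (\<lambda>j. f j + n - 1) s"
  using assms by (induction s) (auto simp: less_imp_not_less)

lemma graft_multilinear:
  assumes "s \<in> multilinear_monomials m" "t \<in> multilinear_monomials n" "i \<in> {1..m}"
  shows "graft n i t s \<in> multilinear_monomials (m + n - 1)"
proof -
  let ?f = "\<lambda>j. if j < i then [j] else if j = i then map (\<lambda>l. l + i - 1) (leaves t) else [j + n - 1]"
  have s: "set (leaves s) = {1..m}" "distinct (leaves s)"
    and t: "set (leaves t) = {1..n}" "distinct (leaves t)"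
    using assms by (simp_all add: multilinear_monomials_iff)
  have "n \<ge> 1"
    using t(1) leaves_nonempty[of t] by (cases n) auto
  have "set (leaves (graft n i t s)) = (\<Union>j\<in>{1..m}. set (?f j))"
    by (simp only: leaves_graft set_concat set_map image_image s)
  also have "\<dots> = {1..m + n - 1}"
  proof (intro equalityI subsetI)
    fix x assume x: "x \<in> {1..m + n - 1}"
    \<comment> \<open>The position of \<open>x\<close> before, inside or after the inserted block
      determines the leaf of \<open>s\<close> that it comes from.\<close>
    consider "x < i" | "i \<le> x" "x < i + n" | "i + n \<le> x"
      by linarith
    thus "x \<in> (\<Union>j\<in>{1..m}. set (?f j))"
    proof cases
      case 1
      thus ?thesis using x assms(3) by (intro UN_I[of x]) auto
    next
      case 2
      have "x + 1 - i \<in> set (leaves t)" "x = (x + 1 - i) + i - 1"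
        using 2 assms(3) by (auto simp: t(1))
      hence "x \<in> set (?f i)"
        by (simp only: less_irrefl if_False if_True refl set_map) (rule image_eqI)
      thus ?thesis
        using assms(3) by blast
    next
      case 3
      thus ?thesis using x assms(3) \<open>n \<ge> 1\<close> by (intro UN_I[of "x + 1 - n"]) auto
    qed
  qed (use assms(3) \<open>n \<ge> 1\<close> in \<open>auto simp: t split: if_splits\<close>)
  finally have set: "set (leaves (graft n i t s)) = {1..m + n - 1}" .
  \<comment> \<open>Distinctness by counting: a list of length \<open>m + n - 1\<close> that covers
    \<open>m + n - 1\<close> values has no repetition.\<close>
  have "length (leaves (graft n i t s)) = (\<Sum>j\<in>{1..m}. length (?f j))"
    using sum_list_distinct_conv_sum_set[OF s(2), of "\<lambda>j. length (?f j)"]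
    by (simp add: leaves_graft length_concat s(1) o_def)
  also have "\<dots> = (\<Sum>j\<in>{1..m}. if j = i then n else 1)"
    using distinct_card[OF t(2)] t(1) by (intro sum.cong) auto
  also have "\<dots> = n + (\<Sum>j\<in>{1..m} - {i}. 1)"
    using assms(3) by (subst sum.remove[of _ i]) auto
  also have "\<dots> = m + n - 1"
    using assms(3) by simp
  finally have "distinct (leaves (graft n i t s))"
    by (intro card_distinct) (simp add: set)
  thus ?thesis
    by (simp add: multilinear_monomials_iff set)
qed

interpretation free: additive_operad "free_operad :: ('k::field, 'g monomial \<Rightarrow>\<^sub>0 'k) operad"
proof (rule additive_operad.intro)
  let ?F = "free_operad :: ('k, 'g monomial \<Rightarrow>\<^sub>0 'k) operad"
  show "module class_ring (component ?F n)" for n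
  proof (rule module_criteria, goal_cases)
    case 1
    show ?case by (rule class_cring.cring_axioms)
  next
    case 3
    thus ?case using Poly_Mapping.keys_add by (fastforce simp: ops_free)
  next
    case 4
    have "\<exists>w\<in>ops ?F n. v + w = 0" if "v \<in> ops ?F n" for v
      using that by (intro bexI[of _ "- v"]) (auto simp: ops_free)
    thus ?case by simp
  next
    case 5
    thus ?case using keys_smult_subset by (fastforce simp: ops_free)
  qed (auto intro!: poly_mapping_eqI simp: ops_free lookup_add algebra_simps)
  show "act ?F n \<sigma> x \<in> ops ?F n" if "\<sigma> permutes {1..n}" "x \<in> ops ?F n" for n \<sigma> x
    using that keys_lin_ext[of "relabel \<sigma>" x] relabel_multilinear[OF _ that(1)]
    by (auto simp: ops_free act_free)
  show "pcomp ?F m n i x y \<in> ops ?F (m + n - 1)"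
    if "i \<in> {1..m}" "x \<in> ops ?F m" "y \<in> ops ?F n" for m n i x y
    using that keys_bilin_ext[of "\<lambda>s t. graft n i t s" x y] graft_multilinear[OF _ _ that(1)]
    by (fastforce simp: ops_free pcomp_free)
  show "unit_op ?F \<in> ops ?F 1"
    by (simp add: ops_free unit_free multilinear_monomials_iff)
qed (simp_all add: act_free pcomp_free lin_ext_add bilin_ext_add_left bilin_ext_add_right)

lemma free_minus:
  assumes "y \<in> ops free_operad n"
  shows "x \<ominus>\<^bsub>component free_operad n\<^esub> y = x - y"
proof -
  have "\<ominus>\<^bsub>component free_operad n\<^esub> y = - y"
    using assms by (intro free.component.minus_equality) (auto simp: ops_free)
  thus ?thesis
    by (simp add: a_minus_def)
qed

lemma operad_hom_lin_ext:
  fixes m :: "'g monomial \<Rightarrow> 'h monomial"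
  assumes "\<And>n t. t \<in> multilinear_monomials n \<Longrightarrow> m t \<in> multilinear_monomials n"
    and "\<And>\<sigma> t. m (relabel \<sigma> t) = relabel \<sigma> (m t)"
    and "m (Var 1) = Var 1"
    and "\<And>n i s t. m (graft n i t s) = graft n i (m t) (m s)"
  shows "operad_hom (free_operad :: ('k::field, _) operad) free_operad (\<lambda>n. lin_ext m)"
proof (rule operad_homI)
  show "lin_ext m x \<in> ops free_operad n" if "x \<in> ops free_operad n" for n and x :: "'g monomial \<Rightarrow>\<^sub>0 'k"
    using that keys_lin_ext[of m x] assms(1) unfolding ops_free by blast
qed (simp_all add: lin_ext_add lin_ext_smult act_free lin_ext_lin_ext unit_free pcomp_free
    lin_ext_bilin_ext assms del: One_nat_def)

text \<open>The variables of the two subtrees may be interleaved. A permutation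
  \<open>\<tau>\<close> moves those of \<open>s\<close> to the first \<open>k\<close> numbers and
  those of \<open>t\<close> to the last \<open>l\<close>; the tree is then the generator
  \<open>g(x_1, x_2)\<close> with \<open>t\<close> inserted into input 2 and afterwards
  \<open>s\<close> into input 1.\<close>

lemma multilinear_Op_eq_graft:
  assumes "Op g s t \<in> multilinear_monomials n"
  obtains k l \<tau> where "n = k + l" "\<tau> permutes {1..n}"
    "relabel \<tau> s \<in> multilinear_monomials k" "relabel (\<lambda>j. \<tau> j - k) t \<in> multilinear_monomials l"
    "relabel \<tau> (Op g s t) =
      graft k 1 (relabel \<tau> s) (graft l 2 (relabel (\<lambda>j. \<tau> j - k) t) (Op g (Var 1) (Var 2)))"
proof -
  define A B where "A = set (leaves s)" and "B = set (leaves t)"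
  define k l where "k = card A" and "l = card B"
  have fin: "finite A" "finite B"
    by (simp_all add: A_def B_def)
  have AB: "A \<union> B = {1..n}" "A \<inter> B = {}" "distinct (leaves s)" "distinct (leaves t)"
    using assms by (simp_all add: multilinear_monomials_iff A_def B_def)
  have n: "n = k + l"
    using card_Un_disjoint[OF fin AB(2)] AB(1) by (simp add: k_def l_def)
  \<comment> \<open>Any enumeration of the two leaf sets will do; the order of the variables does
    not have to be preserved.\<close>
  have "\<exists>f. bij_betw f A {1..k}" "\<exists>f. bij_betw f B {k + 1..k + l}"
    by (intro finite_same_card_bij fin; simp add: k_def l_def)+
  then obtain \<tau>1 \<tau>2 where \<tau>1: "bij_betw \<tau>1 A {1..k}" and \<tau>2: "bij_betw \<tau>2 B {k + 1..k + l}"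
    by (elim exE)
  define \<tau> where "\<tau> j = (if j \<in> A then \<tau>1 j else if j \<in> B then \<tau>2 j else j)" for j
  have "bij_betw \<tau> A {1..k} \<longleftrightarrow> bij_betw \<tau>1 A {1..k}"
    by (rule bij_betw_cong) (simp add: \<tau>_def)
  moreover have "bij_betw \<tau> B {k + 1..k + l} \<longleftrightarrow> bij_betw \<tau>2 B {k + 1..k + l}"
    using AB(2) by (intro bij_betw_cong) (auto simp: \<tau>_def)
  ultimately have \<tau>: "bij_betw \<tau> A {1..k}" "bij_betw \<tau> B {k + 1..k + l}"
    using \<tau>1 \<tau>2 by simp_all
  have "bij_betw \<tau> (A \<union> B) ({1..k} \<union> {k + 1..k + l})"
    by (rule bij_betw_combine[OF \<tau>]) (simp add: disjoint_iff)
  moreover have "{1..k} \<union> {k + 1..k + l} = {1..n}"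
    using n by auto
  ultimately have "bij_betw \<tau> {1..n} {1..n}"
    using AB(1) by simp
  moreover have "\<tau> j = j" if "j \<notin> {1..n}" for j
    using that unfolding AB(1)[symmetric] by (simp add: \<tau>_def)
  ultimately have perm: "\<tau> permutes {1..n}"
    by (rule bij_imp_permutes)
  define v where "v = relabel (\<lambda>j. \<tau> j - k) t"
  have "bij_betw (\<lambda>j. j - k) {k + 1..k + l} {1..l}"
  proof (rule bij_betwI[of _ _ _ "\<lambda>j. j + k"])
    show "(\<lambda>j. j - k) \<in> {k + 1..k + l} \<rightarrow> {1..l}" by auto
    show "(\<lambda>j. j + k) \<in> {1..l} \<rightarrow> {k + 1..k + l}" by (simp add: Pi_iff)
  qed simp_all
  with \<tau>(2) have "bij_betw ((\<lambda>j. j - k) \<circ> \<tau>) B {1..l}"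
    by (rule bij_betw_trans)
  hence v: "v \<in> multilinear_monomials l"
    unfolding v_def using AB(4) by (intro relabel_multilinear_bij) (simp_all add: o_def B_def)
  have "relabel (\<lambda>j. j + k) v = relabel (\<lambda>j. \<tau> j - k + k) t"
    by (simp only: v_def relabel_relabel)
  also have "\<dots> = relabel \<tau> t"
  proof (rule relabel_cong)
    fix j assume "j \<in> set (leaves t)"
    hence "\<tau> j \<in> {k + 1..k + l}"
      using bij_betwE[OF \<tau>(2)] unfolding B_def by blast
    thus "\<tau> j - k + k = \<tau> j" by simp
  qed
  finally have "relabel \<tau> t = relabel (\<lambda>j. j + k) v" ..
  \<comment> \<open>Insertion into input 2 has shifted \<open>v\<close> by 1; insertion of a tree
    with \<open>k\<close> leaves into input 1 adds \<open>k - 1\<close>, which makes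
    \<open>k\<close> in total.\<close>
  moreover have "graft k 1 w (relabel (\<lambda>j. j + 1) v) = relabel (\<lambda>j. j + k) v" for w
  proof -
    have "graft k 1 w (relabel (\<lambda>j. j + 1) v) = relabel (\<lambda>j. j + 1 + k - 1) v"
    proof (rule graft_relabel_gt)
      fix j assume "j \<in> set (leaves v)"
      hence "j \<in> {1..l}"
        using v unfolding multilinear_monomials_iff by blast
      thus "1 < j + 1" by simp
    qed
    also have "\<dots> = relabel (\<lambda>j. j + k) v"
      by (rule relabel_cong) simp
    finally show ?thesis .
  qed
  moreover have "graft l 2 v (Op g (Var 1) (Var 2)) = Op g (Var 1) (relabel (\<lambda>j. j + 1) v)"
    by (auto intro: relabel_cong)
  moreover have "graft k 1 (relabel \<tau> s) (Var 1) = relabel \<tau> s"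
    by simp
  ultimately have "relabel \<tau> (Op g s t) = graft k 1 (relabel \<tau> s) (graft l 2 v (Op g (Var 1) (Var 2)))"
    by (simp only: relabel.simps graft.simps)
  thus ?thesis
    using n perm relabel_multilinear_bij[OF \<tau>(1)[unfolded A_def] AB(3)] v
    unfolding v_def by (rule that[rotated 4])
qed

text \<open>An induction principle: whatever contains the unit and the binary generators and is
  closed under linear combinations, permutations and composition is the whole free operad.
  Multilinear trees are decomposed at the root.\<close>

theorem free_operad_generated:
  fixes K :: "nat \<Rightarrow> ('g monomial \<Rightarrow>\<^sub>0 'k::field) set"
  assumes submodule: "\<And>n. sn_submodule free_operad n (K n)"
    and unit: "Poly_Mapping.single (Var 1) 1 \<in> K 1"
    and generator: "\<And>g. Poly_Mapping.single (Op g (Var 1) (Var 2)) 1 \<in> K 2"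
    and pcomp: "\<And>m n i x y. i \<in> {1..m} \<Longrightarrow> x \<in> K m \<Longrightarrow> y \<in> K n \<Longrightarrow>
      pcomp free_operad m n i x y \<in> K (m + n - 1)"
    and x: "x \<in> ops free_operad n"
  shows "x \<in> K n"
proof -
  have relabel: "Poly_Mapping.single (relabel \<sigma> t) 1 \<in> K n"
    if "\<sigma> permutes {1..n}" "Poly_Mapping.single t 1 \<in> K n" for \<sigma> t n
    using sn_submoduleD(5)[OF submodule that(2,1)] by (simp add: act_free)
  have graft: "Poly_Mapping.single (graft n i t s) 1 \<in> K (m + n - 1)"
    if "i \<in> {1..m}" "Poly_Mapping.single s 1 \<in> K m" "Poly_Mapping.single t 1 \<in> K n" for m n i s t
    using pcomp[OF that] by (simp add: pcomp_free)
  \<comment> \<open>Subtrees carry arbitrary sets of variables. Quantifying over a relabelling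
    \<open>\<rho>\<close> makes the hypothesis applicable after the renumbering by
    \<open>\<tau>\<close> and, for the right subtree, the further shift by \<open>k\<close>.\<close>
  have monomial: "Poly_Mapping.single (relabel \<rho> t) 1 \<in> K n"
    if "relabel \<rho> t \<in> multilinear_monomials n" for t \<rho> n
    using that
  proof (induction t arbitrary: \<rho> n)
    case (Var j)
    hence *: "{\<rho> j} = {1..n}"
      by (simp add: multilinear_monomials_iff)
    have "n = 1"
      using arg_cong[OF *, of card] by simp
    moreover have "\<rho> j = 1"
      using * unfolding \<open>n = 1\<close> by simp
    ultimately show ?case
      using unit by simp
  next
    case (Op g s1 s2)
    obtain k l \<tau> where \<tau>: "n = k + l" "\<tau> permutes {1..n}"
      "relabel \<tau> (relabel \<rho> s1) \<in> multilinear_monomials k"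
      "relabel (\<lambda>j. \<tau> j - k) (relabel \<rho> s2) \<in> multilinear_monomials l"
      "relabel \<tau> (Op g (relabel \<rho> s1) (relabel \<rho> s2)) = graft k 1 (relabel \<tau> (relabel \<rho> s1))
        (graft l 2 (relabel (\<lambda>j. \<tau> j - k) (relabel \<rho> s2)) (Op g (Var 1) (Var 2)))"
      by (rule multilinear_Op_eq_graft[OF Op.prems[unfolded relabel.simps]])
    have K1: "Poly_Mapping.single (relabel \<tau> (relabel \<rho> s1)) 1 \<in> K k"
      using Op.IH(1) \<tau>(3) unfolding relabel_relabel by blast
    have K2: "Poly_Mapping.single (relabel (\<lambda>j. \<tau> j - k) (relabel \<rho> s2)) 1 \<in> K l"
      using Op.IH(2) \<tau>(4) unfolding relabel_relabel by blast
    have "Poly_Mapping.single (relabel \<tau> (Op g (relabel \<rho> s1) (relabel \<rho> s2))) 1 \<in> K (2 + l - 1 + k - 1)"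
      unfolding \<tau>(5) by (intro graft K1 K2 generator) simp_all
    moreover have "2 + l - 1 + k - 1 = n"
      using \<tau>(1) by simp
    ultimately have "Poly_Mapping.single (relabel \<tau> (relabel \<rho> (Op g s1 s2))) 1 \<in> K n"
      by simp
    \<comment> \<open>The permutation that separated the variables is undone by the action of its
      inverse.\<close>
    from relabel[OF permutes_inv[OF \<tau>(2)] this] show ?case
      unfolding relabel_inverse[OF \<tau>(2)] .
  qed
  have single: "Poly_Mapping.single t c \<in> K n" if "t \<in> multilinear_monomials n" for t c
    using sn_submoduleD(4)[OF submodule monomial[of "\<lambda>j. j" t n], of c] that by simp
  have "(\<Sum>t\<in>A. Poly_Mapping.single t (Poly_Mapping.lookup x t)) \<in> K n"
    if "A \<subseteq> Poly_Mapping.keys x" for A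
    using finite_subset[OF that finite_keys] that
  proof (induction A rule: finite_induct)
    case empty
    show ?case using sn_submoduleD(2)[OF submodule[of n]] by simp
  next
    case (insert t A)
    have "Poly_Mapping.single t (Poly_Mapping.lookup x t) \<in> K n"
      using insert.prems x by (intro single) (auto simp: ops_free)
    with insert show ?case using sn_submoduleD(3)[OF submodule[of n]] by simp
  qed
  from this[of "Poly_Mapping.keys x"] show ?thesis
    by (simp add: poly_mapping_sum_single)
qed

section \<open>Monomials over the white product\<close>

text \<open>\<open>Succ\<close> only exchanges two subtrees, so the leaves are reordered but none is
  lost or repeated. Multilinearity therefore passes through \<open>V_part\<close> in both
  directions.\<close>

lemma mset_leaves_V_part: "mset (leaves (V_part t)) = mset (leaves t)"
  by (induction t rule: V_part.induct) auto

lemma V_part_multilinear_iff: "V_part t \<in> multilinear_monomials n \<longleftrightarrow> t \<in> multilinear_monomials n"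
  using mset_eq_setD[OF mset_leaves_V_part[of t]] mset_eq_imp_distinct_iff[OF mset_leaves_V_part[of t]]
  by (simp add: multilinear_monomials_iff)

lemma V_part_relabel: "V_part (relabel \<sigma> t) = relabel \<sigma> (V_part t)"
  by (induction t rule: V_part.induct) auto

lemma V_part_graft: "V_part (graft n i t s) = graft n i (V_part t) (V_part s)"
  by (induction s rule: V_part.induct) (auto simp: V_part_relabel)

lemma leaves_map_monomial: "leaves (map_monomial f t) = leaves t"
  by (induction t) auto

lemma map_monomial_relabel: "map_monomial f (relabel \<sigma> t) = relabel \<sigma> (map_monomial f t)"
  by (induction t) auto

lemma map_monomial_graft: "map_monomial f (graft n i t s) = graft n i (map_monomial f t) (map_monomial f s)"
  by (induction s) (auto simp: map_monomial_relabel)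

lemma V_part_map_Prec: "V_part (map_monomial Prec t) = t"
  by (induction t) auto

lemma operad_hom_V_part: "operad_hom free_operad free_operad (\<lambda>n. lin_ext V_part)"
  by (rule operad_hom_lin_ext) (auto simp: V_part_multilinear_iff V_part_relabel V_part_graft)

lemma operad_hom_map_monomial: "operad_hom free_operad free_operad (\<lambda>n. lin_ext (map_monomial f))"
  by (rule operad_hom_lin_ext)
    (auto simp: multilinear_monomials_iff leaves_map_monomial map_monomial_relabel map_monomial_graft)

lemma lin_ext_V_part_Prec: "lin_ext V_part (lin_ext (map_monomial Prec) x) = x"
  by (simp add: lin_ext_lin_ext V_part_map_Prec lin_ext_ident)

section \<open>Monomials with at most three leaves\<close>

lemma length_leaves_pos: "length (leaves t) \<ge> 1"
  using leaves_nonempty[of t] by (cases "leaves t") auto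

lemma leaves_singletonE:
  assumes "leaves t = [j]"
  shows "t = Var j"
proof (cases t)
  case (Op g r s)
  moreover have "length (leaves t) = 1"
    using assms by simp
  ultimately show ?thesis
    using length_leaves_pos[of r] length_leaves_pos[of s] by simp
qed (use assms in simp)

lemma leaves_pairE:
  assumes "leaves t = [j, k]"
  obtains g where "t = Op g (Var j) (Var k)"
proof (cases t)
  case (Op g r s)
  have "length (leaves r) = 1" "length (leaves s) = 1"
    using Op arg_cong[OF assms, of length] length_leaves_pos[of r] length_leaves_pos[of s] by simp_all
  then obtain a b where "leaves r = [a]" "leaves s = [b]"
    by (auto simp: length_Suc_conv)
  thus ?thesis
    using Op assms that by (simp add: leaves_singletonE)
qed (use assms in simp)

lemma leaves_tripleE:
  assumes "leaves t = [i, j, k]"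
  obtains (left) g h where "t = Op g (Op h (Var i) (Var j)) (Var k)"
    | (right) g h where "t = Op g (Var i) (Op h (Var j) (Var k))"
proof (cases t)
  case (Op g r s)
  have len: "length (leaves r) + length (leaves s) = 3"
    using Op arg_cong[OF assms, of length] by simp
  show ?thesis
  proof (cases "length (leaves r) = 1")
    case True
    then obtain a where "leaves r = [a]"
      by (auto simp: length_Suc_conv)
    hence "r = Var i" "leaves s = [j, k]"
      using Op assms by (auto simp: leaves_singletonE)
    thus ?thesis
      using Op right by (metis leaves_pairE)
  next
    case False
    hence "length (leaves s) = 1"
      using len length_leaves_pos[of r] length_leaves_pos[of s] by linarith
    then obtain a where "leaves s = [a]"
      by (auto simp: length_Suc_conv)
    hence "s = Var k" "leaves r = [i, j]"
      using Op assms by (auto simp: leaves_singletonE append_eq_Cons_conv)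
    thus ?thesis
      using Op left by (metis leaves_pairE)
  qed
qed (use assms in simp)

lemma multilinear_monomials_0: "multilinear_monomials 0 = {}"
  by (auto simp: multilinear_monomials_iff)

lemma multilinear_monomials_1: "multilinear_monomials 1 = {Var 1}"
proof -
  have "t = Var 1" if "t \<in> multilinear_monomials 1" for t :: "'a monomial"
  proof -
    have "set (leaves t) = {1}" "distinct (leaves t)"
      using that by (simp_all add: multilinear_monomials_iff)
    hence "leaves t = [1]"
      using distinct_card[of "leaves t"] by (cases "leaves t"; cases "tl (leaves t)") auto
    thus ?thesis by (rule leaves_singletonE)
  qed
  thus ?thesis by (auto simp: multilinear_monomials_iff)
qed

lemma multilinear_monomials_2:
  "multilinear_monomials 2 = (\<Union>g. {Op g (Var 1) (Var 2), Op g (Var 2) (Var 1)})"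
proof -
  have *: "{1..2} = {1, 2 :: nat}" by auto
  have sub: "t \<in> (\<Union>g. {Op g (Var 1) (Var 2), Op g (Var 2) (Var 1)})"
    if "t \<in> multilinear_monomials 2" for t :: "'a monomial"
  proof -
    have "leaves t \<in> permutations_of_set {1, 2}"
      using that by (simp only: multilinear_monomials_def * mem_Collect_eq)
    hence "leaves t = [1, 2] \<or> leaves t = [2, 1]"
      by (simp add: permutations_of_set_doubleton)
    thus ?thesis
    proof
      assume "leaves t = [1, 2]"
      then obtain g where "t = Op g (Var 1) (Var 2)"
        by (rule leaves_pairE)
      thus ?thesis by blast
    next
      assume "leaves t = [2, 1]"
      then obtain g where "t = Op g (Var 2) (Var 1)"
        by (rule leaves_pairE)
      thus ?thesis by blast
    qed
  qed
  have mem: "Op g (Var 1) (Var 2) \<in> multilinear_monomials 2"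
    "Op g (Var 2) (Var 1) \<in> multilinear_monomials 2" for g :: 'a
    unfolding multilinear_monomials_iff * leaves.simps by (simp_all add: insert_commute)
  show ?thesis
    by (intro equalityI subsetI[OF sub] UN_least insert_subsetI empty_subsetI mem)
qed


section \<open>Quadratic ideals\<close>

lemma quadratic_ideal_ideal:
  "R \<subseteq> ops free_operad 3 \<Longrightarrow> operad_ideal free_operad (quadratic_ideal R)"
  unfolding quadratic_ideal_def by (rule free.ideal_generated_ideal) auto

lemma quadratic_ideal_subset: "R \<subseteq> quadratic_ideal R 3"
  using ideal_generated_subset[of "\<lambda>n. if n = 3 then R else {}" 3] by (simp add: quadratic_ideal_def)

lemma quadratic_ideal_least:
  assumes "operad_ideal free_operad I" "R \<subseteq> I 3"
  shows "quadratic_ideal R n \<subseteq> I n"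
  unfolding quadratic_ideal_def by (rule ideal_generated_least) (use assms in auto)

lemma pcomp_free_unit_right: "pcomp free_operad m 1 i x (Poly_Mapping.single (Var 1) c) = pm_smult c x"
proof -
  have [simp]: "graft 1 i (Var 1) s = s" for s :: "'a monomial"
    by (induction s) auto
  have "pcomp free_operad m 1 i x (Poly_Mapping.single (Var 1) c) =
      (\<Sum>s\<in>Poly_Mapping.keys x. Poly_Mapping.single s (Poly_Mapping.lookup x s * c))"
    unfolding pcomp_free
    by (subst bilin_ext_superset[of "Poly_Mapping.keys x" _ "{Var 1}"]) (auto simp del: One_nat_def)
  also have "\<dots> = lin_ext (\<lambda>s. s) (pm_smult c x)"
    by (subst lin_ext_superset[OF _ keys_smult_subset]) (simp_all add: mult.commute)
  finally show ?thesis by (simp add: lin_ext_ident)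
qed

lemma pcomp_free_unit_left: "pcomp free_operad 1 n 1 (Poly_Mapping.single (Var 1) c) x = pm_smult c x"
proof -
  have "pcomp free_operad 1 n 1 (Poly_Mapping.single (Var 1) c) x =
      (\<Sum>t\<in>Poly_Mapping.keys x. Poly_Mapping.single t (c * Poly_Mapping.lookup x t))"
    unfolding pcomp_free
    by (subst bilin_ext_superset[of "{Var 1}" _ "Poly_Mapping.keys x"]) auto
  also have "\<dots> = lin_ext (\<lambda>s. s) (pm_smult c x)"
    by (subst lin_ext_superset[OF _ keys_smult_subset]) simp_all
  finally show ?thesis by (simp add: lin_ext_ident)
qed

lemma ops_free_1E:
  assumes "x \<in> ops free_operad 1"
  obtains c where "x = Poly_Mapping.single (Var 1) c"
proof -
  have "Poly_Mapping.keys x \<subseteq> {Var 1}"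
    using assms by (simp only: ops_free multilinear_monomials_1 mem_Collect_eq)
  hence "lin_ext (\<lambda>t. t) x = Poly_Mapping.single (Var 1) (Poly_Mapping.lookup x (Var 1))"
    by (subst lin_ext_superset[of "{Var 1}"]) simp_all
  thus ?thesis
    using that by (simp add: lin_ext_ident)
qed

text \<open>The ideal generated in arity 3 does not grow in arity 3, since the only unary operations are scalars.\<close>

lemma quadratic_ideal_3:
  fixes R :: "('g monomial \<Rightarrow>\<^sub>0 'k::field) set"
  assumes R: "sn_submodule free_operad 3 R"
  shows "quadratic_ideal R 3 = R"
proof -
  \<comment> \<open>An explicit ideal whose arity 3 part is \<open>R\<close>: zero below arity 3 and
    everything above. It bounds the generated ideal from above.\<close>
  define J where "J n = (if n < 3 then {0} else if n = 3 then R else ops free_operad n)" for n :: nat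
  have J: "sn_submodule free_operad n (J n)" for n
    unfolding J_def using R operad_idealD(1)[OF free.operad_ideal_zero, unfolded zero_free]
      operad_idealD(1)[OF free.operad_ideal_ops] by (auto split: if_split)
  have zero: "0 \<in> J n" for n
    using sn_submoduleD(2)[OF J[of n]] by simp
  have "operad_ideal free_operad J"
    unfolding operad_ideal_def
  proof (intro conjI allI ballI impI J)
    fix m n i x y
    assume i: "i \<in> {1..m}" and x: "x \<in> ops free_operad m" and y: "y \<in> ops free_operad n"
      and xy: "x \<in> J m \<or> y \<in> J n"
    have "y = 0" if "n = 0"
      using y that by (simp add: ops_free multilinear_monomials_0)
    moreover have "m = 1 \<or> m > 1" "n = 0 \<or> n = 1 \<or> n > 1"
      using i by auto
    \<comment> \<open>A nonzero factor from \<open>J\<close> has arity at least 3, and the arity 0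
      part is zero. So a nonzero composite either lands in arity at least 4 or is an element of
      \<open>R\<close> composed with a scalar.\<close>
    ultimately have "x = 0 \<or> y = 0 \<or> m + n > 4 \<or> m = 3 \<and> n = 1 \<and> x \<in> R \<or> m = 1 \<and> n = 3 \<and> y \<in> R"
      using xy by (elim disjE) (simp_all add: J_def split: if_splits)
    then consider "x = 0 \<or> y = 0" | "m + n > 4" | "m = 3" "n = 1" "x \<in> R" | "m = 1" "n = 3" "y \<in> R"
      by blast
    thus "pcomp free_operad m n i x y \<in> J (m + n - 1)"
    proof cases
      case 1
      thus ?thesis by (auto simp: pcomp_free zero)
    next
      case 2
      hence "\<not> m + n - 1 < 3" "m + n - 1 \<noteq> 3" by arith+
      thus ?thesis using free.pcomp_closed[OF i x y] by (simp only: J_def if_False)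
    next
      case 3
      obtain c where "y = Poly_Mapping.single (Var 1) c"
        using y unfolding \<open>n = 1\<close> by (rule ops_free_1E)
      thus ?thesis
        using sn_submoduleD(4)[OF R \<open>x \<in> R\<close>, of c] 3 pcomp_free_unit_right[of m i x c] by (simp add: J_def)
    next
      case 4
      obtain c where "x = Poly_Mapping.single (Var 1) c"
        using x unfolding \<open>m = 1\<close> by (rule ops_free_1E)
      moreover have "i = 1"
        using i 4 by simp
      ultimately show ?thesis
        using sn_submoduleD(4)[OF R \<open>y \<in> R\<close>, of c] 4 pcomp_free_unit_left[of n c y] by (simp add: J_def)
    qed
  qed
  from quadratic_ideal_least[OF this, of R 3] have "quadratic_ideal R 3 \<subseteq> R"
    by (simp add: J_def)
  thus ?thesis
    using quadratic_ideal_subset by blast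
qed


section \<open>The span of the monomials evaluating to the identity word\<close>

lemma submodule_free_memI:
  assumes N: "LinearCombinations.submodule class_ring N (component free_operad n)"
    and "\<And>t. t \<in> Poly_Mapping.keys f \<Longrightarrow> Poly_Mapping.single t 1 \<in> N"
  shows "f \<in> N"
proof -
  interpret N: LinearCombinations.submodule class_ring N "component free_operad n" by (fact N)
  have single: "Poly_Mapping.single t c \<in> N" if "t \<in> Poly_Mapping.keys f" for t c
    using N.smult_closed[of c, OF _ assms(2)[OF that]] by simp
  have "(\<Sum>t\<in>A. Poly_Mapping.single t (Poly_Mapping.lookup f t)) \<in> N"
    if "A \<subseteq> Poly_Mapping.keys f" for A
    using finite_subset[OF that finite_keys] that
  proof (induction A rule: finite_induct)
    case empty
    show ?case using N.zero_closed by simp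
  next
    case (insert t A)
    thus ?case using N.m_closed[OF single] by simp
  qed
  from this[of "Poly_Mapping.keys f"] show ?thesis
    by (simp add: poly_mapping_sum_single)
qed

lemma submodule_free_keys:
  assumes "A \<subseteq> multilinear_monomials n"
  shows "LinearCombinations.submodule class_ring {f. Poly_Mapping.keys f \<subseteq> A} (component free_operad n)"
proof (intro LinearCombinations.submodule.intro free.component_module)
  show "v \<oplus>\<^bsub>component free_operad n\<^esub> w \<in> {f. Poly_Mapping.keys f \<subseteq> A}"
    if "v \<in> {f. Poly_Mapping.keys f \<subseteq> A}" "w \<in> {f. Poly_Mapping.keys f \<subseteq> A}" for v w :: "'a monomial \<Rightarrow>\<^sub>0 'b"
    using that Poly_Mapping.keys_add[of v w] by auto
  show "c \<odot>\<^bsub>component free_operad n\<^esub> v \<in> {f. Poly_Mapping.keys f \<subseteq> A}"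
    if "v \<in> {f. Poly_Mapping.keys f \<subseteq> A}" for c and v :: "'a monomial \<Rightarrow>\<^sub>0 'b"
    using that keys_smult_subset[of c v] by auto
qed (use assms in \<open>auto simp: ops_free\<close>)

text \<open>The trees in which \<open>x_i\<close> and \<open>x_j\<close> are multiplied first and
  \<open>x_k\<close> last, with both orders at both nodes. For 1, 2, 3 this is a basis of the tensor
  square of V, and for 3, 2, 1 a basis of its translate by (13).\<close>

definition left_combs :: "nat \<Rightarrow> nat \<Rightarrow> nat \<Rightarrow> 'g monomial set" where
  "left_combs i j k = (\<Union>g h. {Op g (Op h (Var i) (Var j)) (Var k), Op g (Op h (Var j) (Var i)) (Var k),
     Op g (Var k) (Op h (Var i) (Var j)), Op g (Var k) (Op h (Var j) (Var i))})"

lemma V_tensor_V_eq: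
  "(V_tensor_V :: ('g monomial \<Rightarrow>\<^sub>0 'k::field) set) = {f. Poly_Mapping.keys f \<subseteq> left_combs 1 2 3}"
proof -
  let ?F = "free_operad :: ('k::field, 'g monomial \<Rightarrow>\<^sub>0 'k) operad"
  let ?S = "{pcomp ?F 2 2 1 \<mu> \<nu> |\<mu> \<nu>. \<mu> \<in> ops ?F 2 \<and> \<nu> \<in> ops ?F 2}"
  have V: "(V_tensor_V :: ('g monomial \<Rightarrow>\<^sub>0 'k) set) = free.component.span 3 ?S"
    by (simp add: V_tensor_V_def)
  have *: "{1..3} = {1, 2, 3 :: nat}" by auto
  have "left_combs 1 2 3 \<subseteq> multilinear_monomials 3"
    by (auto simp: left_combs_def multilinear_monomials_iff *)
  note sub = submodule_free_keys[OF this]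
  have graft: "graft 2 1 t s \<in> left_combs 1 2 3"
    if "s \<in> multilinear_monomials 2" "t \<in> multilinear_monomials 2" for s t :: "'g monomial"
    using that unfolding multilinear_monomials_2 left_combs_def by (auto simp: relabel_cong)
  \<comment> \<open>The outer operation may be \<open>g(x_1, x_2)\<close> or
    \<open>g(x_2, x_1)\<close>; accordingly \<open>x_3\<close> stands to the right or to the left of
    the tree inserted into input 1.\<close>
  have eq: "Op g r (Var 3) = graft 2 1 r (Op g (Var 1) (Var 2))"
    "Op g (Var 3) r = graft 2 1 r (Op g (Var 2) (Var 1))" for g and r :: "'g monomial"
    by simp_all
  have mem: "graft 2 1 r s \<in> (\<lambda>(s, r). graft 2 1 r s) ` (multilinear_monomials 2 \<times> multilinear_monomials 2)"
    if "s \<in> multilinear_monomials 2" "r \<in> multilinear_monomials 2" for r s :: "'g monomial"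
    using that by (intro image_eqI[of _ _ "(s, r)"]) simp_all
  have graft_image: "left_combs 1 2 3 \<subseteq>
      (\<lambda>(s, r). graft 2 1 r s) ` (multilinear_monomials 2 \<times> multilinear_monomials 2 :: ('g monomial \<times> _) set)"
    unfolding left_combs_def eq
    by (intro UN_least insert_subsetI empty_subsetI mem) (simp_all add: multilinear_monomials_2)
  have "?S \<subseteq> {f. Poly_Mapping.keys f \<subseteq> left_combs 1 2 3}"
  proof (clarify)
    fix \<mu> \<nu> t assume "\<mu> \<in> ops ?F 2" "\<nu> \<in> ops ?F 2" "t \<in> Poly_Mapping.keys (pcomp ?F 2 2 1 \<mu> \<nu>)"
    hence "t \<in> (\<lambda>(s, r). graft 2 1 r s) ` (multilinear_monomials 2 \<times> multilinear_monomials 2)"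
      using keys_bilin_ext[of "\<lambda>s t. graft 2 1 t s" \<mu> \<nu>] unfolding ops_free pcomp_free by blast
    thus "t \<in> left_combs 1 2 3"
      using graft by (elim imageE SigmaE) simp
  qed
  hence "free.component.span 3 ?S \<subseteq> {f. Poly_Mapping.keys f \<subseteq> left_combs 1 2 3}"
    by (rule free.component.span_is_subset[OF _ sub])
  moreover have "f \<in> free.component.span 3 ?S" if f: "Poly_Mapping.keys f \<subseteq> left_combs 1 2 3" for f
  proof (rule submodule_free_memI)
    have S: "?S \<subseteq> ops ?F 3"
    proof (clarify)
      fix \<mu> \<nu> assume "\<mu> \<in> ops ?F 2" "\<nu> \<in> ops ?F 2"
      thus "pcomp ?F 2 2 1 \<mu> \<nu> \<in> ops ?F 3"
        using free.pcomp_closed[of 1 2 \<mu> \<nu> 2] by simp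
    qed
    show "LinearCombinations.submodule class_ring (free.component.span 3 ?S) (component ?F 3)"
      using S by (rule free.component.span_is_submodule)
    fix t assume "t \<in> Poly_Mapping.keys f"
    hence "t \<in> left_combs 1 2 3" using f by blast
    then obtain s r where "s \<in> multilinear_monomials 2" "r \<in> multilinear_monomials 2" "t = graft 2 1 r s"
      using graft_image by auto
    hence "Poly_Mapping.single t 1 = pcomp ?F 2 2 1 (Poly_Mapping.single s 1) (Poly_Mapping.single r 1)"
      "Poly_Mapping.single s 1 \<in> ops ?F 2" "Poly_Mapping.single r 1 \<in> ops ?F 2"
      by (simp_all add: pcomp_free ops_free)
    hence "Poly_Mapping.single t 1 \<in> ?S" by blast
    thus "Poly_Mapping.single t 1 \<in> free.component.span 3 ?S"
      using free.component.in_own_span[OF S] by blast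
  qed
  ultimately show ?thesis
    unfolding V by blast
qed

text \<open>The two bracketings of the word account for the two families, and the choice of
  \<open>Prec\<close> or \<open>Succ\<close> at each of the two nodes for the four orders within a
  family.\<close>

lemma V_part_identity_word:
  "V_part ` {t. leaves t = [1, 2, 3]} = left_combs 1 2 3 \<union> left_combs 3 2 1"
proof (intro equalityI subsetI)
  fix u :: "'a monomial" assume "u \<in> V_part ` {t. leaves t = [1, 2, 3]}"
  then obtain t where t: "leaves t = [1, 2, 3]" "u = V_part t" by blast
  from t(1) show "u \<in> left_combs 1 2 3 \<union> left_combs 3 2 1"
  proof (cases rule: leaves_tripleE)
    case (left g h)
    thus ?thesis using t(2) by (cases g; cases h) (auto simp: left_combs_def)
  next
    case (right g h)
    thus ?thesis using t(2) by (cases g; cases h) (auto simp: left_combs_def)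
  qed
next
  fix u :: "'a monomial" assume u: "u \<in> left_combs 1 2 3 \<union> left_combs 3 2 1"
  have *: "V_part t \<in> V_part ` {t. leaves t = [1, 2, 3]}" if "leaves t = [1, 2, 3]" for t :: "'a white monomial"
    using that by blast
  have "V_part (Op a (Op b (Var 1) (Var 2)) (Var 3)) \<in> V_part ` {t. leaves t = [1, 2, 3]}"
    "V_part (Op a (Var 1) (Op b (Var 2) (Var 3))) \<in> V_part ` {t. leaves t = [1, 2, 3]}" for a b :: "'a white"
    by (rule *, simp)+
  \<comment> \<open>The four choices at the outer and the inner node exhaust the four shapes in
    \<open>left_combs\<close>.\<close>
  note this[of "Prec _" "Prec _"] this[of "Prec _" "Succ _"] this[of "Succ _" "Prec _"] this[of "Succ _" "Succ _"]
  with u show "u \<in> V_part ` {t. leaves t = [1, 2, 3]}"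
    unfolding left_combs_def V_part.simps by blast
qed

lemma id_plus_13_V_tensor_V_eq:
  "id_plus_13_V_tensor_V = {f. Poly_Mapping.keys f \<subseteq> V_part ` {t. leaves t = [1, 2, 3]}}"
proof -
  let ?\<tau> = "Transposition.transpose 1 (3::nat)"
  have \<tau>: "?\<tau> 1 = 3" "?\<tau> 2 = 2" "?\<tau> 3 = 1"
    by (simp_all add: Transposition.transpose_def)
  have relabel: "relabel ?\<tau> ` left_combs 1 2 3 = left_combs 3 2 1"
    "relabel ?\<tau> ` left_combs 3 2 1 = left_combs 1 2 3"
    unfolding left_combs_def image_UN image_insert image_empty relabel.simps \<tau> by auto
  show ?thesis
    unfolding id_plus_13_V_tensor_V_def V_tensor_V_eq V_part_identity_word
  proof (intro equalityI subsetI)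
    fix f :: "'a monomial \<Rightarrow>\<^sub>0 'b"
    assume "f \<in> {f. Poly_Mapping.keys f \<subseteq> left_combs 1 2 3} <+>\<^bsub>component free_operad 3\<^esub>
      act free_operad 3 ?\<tau> ` {f. Poly_Mapping.keys f \<subseteq> left_combs 1 2 3}"
    then obtain g h where "f = g + lin_ext (relabel ?\<tau>) h"
      "Poly_Mapping.keys g \<subseteq> left_combs 1 2 3" "Poly_Mapping.keys h \<subseteq> left_combs 1 2 3"
      by (auto simp: set_add_def' act_free)
    thus "f \<in> {f. Poly_Mapping.keys f \<subseteq> left_combs 1 2 3 \<union> left_combs 3 2 1}"
      using Poly_Mapping.keys_add[of g "lin_ext (relabel ?\<tau>) h"] keys_lin_ext[of "relabel ?\<tau>" h]
        relabel(1) by blast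
  next
    fix f :: "'a monomial \<Rightarrow>\<^sub>0 'b"
    assume f: "f \<in> {f. Poly_Mapping.keys f \<subseteq> left_combs 1 2 3 \<union> left_combs 3 2 1}"
    define A where "A = Poly_Mapping.keys f \<inter> left_combs 1 2 3"
    define g where "g = (\<Sum>t\<in>A. Poly_Mapping.single t (Poly_Mapping.lookup f t))"
    define h where "h = (\<Sum>t\<in>Poly_Mapping.keys f - A. Poly_Mapping.single t (Poly_Mapping.lookup f t))"
    have "f = g + h"
      using poly_mapping_sum_single[of f] sum.subset_diff[of A "Poly_Mapping.keys f"
          "\<lambda>t. Poly_Mapping.single t (Poly_Mapping.lookup f t)"]
      by (simp add: g_def h_def A_def add.commute)
    moreover have "Poly_Mapping.keys g \<subseteq> left_combs 1 2 3"
      using keys_sum_single_subset[of "\<lambda>t. t" "Poly_Mapping.lookup f" A] by (auto simp: g_def A_def)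
    moreover have "Poly_Mapping.keys h \<subseteq> left_combs 3 2 1"
      using keys_sum_single_subset[of "\<lambda>t. t" "Poly_Mapping.lookup f" "Poly_Mapping.keys f - A"] f
      by (auto simp: h_def A_def)
    hence "Poly_Mapping.keys (lin_ext (relabel ?\<tau>) h) \<subseteq> left_combs 1 2 3"
      using keys_lin_ext[of "relabel ?\<tau>" h] relabel(2) by blast
    \<comment> \<open>The transposition is an involution, so \<open>h\<close> is the image of its
      own image, and that image is supported on \<open>left_combs 1 2 3\<close>.\<close>
    moreover have "act free_operad 3 ?\<tau> (lin_ext (relabel ?\<tau>) h) = h"
      by (simp add: act_free lin_ext_lin_ext relabel_relabel lin_ext_ident)
    ultimately show "f \<in> {f. Poly_Mapping.keys f \<subseteq> left_combs 1 2 3} <+>\<^bsub>component free_operad 3\<^esub>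
      act free_operad 3 ?\<tau> ` {f. Poly_Mapping.keys f \<subseteq> left_combs 1 2 3}"
      unfolding set_add_def' by (intro UN_I[of g] UN_I[of h]) (auto simp del: One_nat_def intro: rev_image_eqI)
  qed
qed

section \<open>Relations of the white product\<close>

text \<open>The coefficient of the word \<open>w\<close> when \<open>f\<close> is evaluated in As(n)
  tensored with the free operad on V, before relations of P are imposed.\<close>

definition word_sum :: "('g white monomial \<Rightarrow>\<^sub>0 'k::field) \<Rightarrow> nat list \<Rightarrow> 'g monomial \<Rightarrow>\<^sub>0 'k" where
  "word_sum f w = (\<Sum>t\<in>{t \<in> Poly_Mapping.keys f. leaves t = w}.
     Poly_Mapping.single (V_part t) (Poly_Mapping.lookup f t))"

lemma keys_word_sum: "Poly_Mapping.keys (word_sum f w) \<subseteq> V_part ` {t \<in> Poly_Mapping.keys f. leaves t = w}"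
  unfolding word_sum_def by (rule keys_sum_single_subset)

text \<open>Each monomial has exactly one leaf word, so the sum over the support may be grouped by
  words.\<close>

lemma lin_ext_V_part_eq_sum_word_sum:
  assumes "f \<in> ops free_operad n"
  shows "lin_ext V_part f = (\<Sum>w\<in>permutations_of_set {1..n}. word_sum f w)"
  unfolding word_sum_def lin_ext_def
  using assms by (intro sum.group[symmetric]) (auto simp: ops_free multilinear_monomials_def)

lemma pm_smult_zero [simp]: "pm_smult c 0 = 0"
  by (rule poly_mapping_eqI) simp

lemma carrier_As_tensor: "carrier (As_tensor n M) = permutations_of_set {1..n} \<rightarrow>\<^sub>E carrier M"
  and add_As_tensor: "u \<oplus>\<^bsub>As_tensor n M\<^esub> v = (\<lambda>w\<in>permutations_of_set {1..n}. u w \<oplus>\<^bsub>M\<^esub> v w)"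
  and zero_As_tensor: "\<zero>\<^bsub>As_tensor n M\<^esub> = (\<lambda>w\<in>permutations_of_set {1..n}. \<zero>\<^bsub>M\<^esub>)"
  and smult_As_tensor: "c \<odot>\<^bsub>As_tensor n M\<^esub> u = (\<lambda>w\<in>permutations_of_set {1..n}. c \<odot>\<^bsub>M\<^esub> u w)"
  by (simp_all add: As_tensor_def)

text \<open>The natural map is a finite sum formed inside \<open>As_tensor\<close>; these laws allow
  it to be computed one summand at a time.\<close>

lemma abelian_monoid_As_tensor:
  assumes "abelian_group M"
  shows "abelian_monoid (As_tensor n M)"
proof -
  interpret M: abelian_group M by fact
  show ?thesis
  proof (rule abelian_monoidI)
    fix x y z
    assume "x \<in> carrier (As_tensor n M)" "y \<in> carrier (As_tensor n M)" "z \<in> carrier (As_tensor n M)"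
    note mem = this[unfolded carrier_As_tensor, THEN PiE_mem]
    show "x \<oplus>\<^bsub>As_tensor n M\<^esub> y \<oplus>\<^bsub>As_tensor n M\<^esub> z = x \<oplus>\<^bsub>As_tensor n M\<^esub> (y \<oplus>\<^bsub>As_tensor n M\<^esub> z)"
      unfolding add_As_tensor by (rule restrict_ext) (simp add: M.a_assoc mem del: One_nat_def)
  next
    fix x y
    assume "x \<in> carrier (As_tensor n M)" "y \<in> carrier (As_tensor n M)"
    note mem = this[unfolded carrier_As_tensor, THEN PiE_mem]
    show "x \<oplus>\<^bsub>As_tensor n M\<^esub> y = y \<oplus>\<^bsub>As_tensor n M\<^esub> x"
      unfolding add_As_tensor by (rule restrict_ext) (simp add: M.a_comm mem del: One_nat_def)
    show "x \<oplus>\<^bsub>As_tensor n M\<^esub> y \<in> carrier (As_tensor n M)"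
      unfolding add_As_tensor carrier_As_tensor by (simp add: mem del: One_nat_def)
  next
    fix x
    assume x: "x \<in> carrier (As_tensor n M)"
    note mem = x[unfolded carrier_As_tensor, THEN PiE_mem]
    have "\<zero>\<^bsub>As_tensor n M\<^esub> \<oplus>\<^bsub>As_tensor n M\<^esub> x = restrict x (permutations_of_set {1..n})"
      unfolding add_As_tensor zero_As_tensor by (rule restrict_ext) (simp add: mem del: One_nat_def)
    also have "\<dots> = x"
      using x unfolding carrier_As_tensor by (intro extensional_restrict) (simp add: PiE_iff)
    finally show "\<zero>\<^bsub>As_tensor n M\<^esub> \<oplus>\<^bsub>As_tensor n M\<^esub> x = x" .
  qed (simp add: carrier_As_tensor zero_As_tensor)
qed

text \<open>A monomial contributes only at its own leaf word, so the value at \<open>w\<close>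
  collects the classes of the monomials with that word. The sum is built up over finite subsets of
  the support.\<close>

lemma white_map_eq:
  fixes R :: "('g monomial \<Rightarrow>\<^sub>0 'k::field) set"
  assumes R: "R \<subseteq> ops free_operad 3" and f: "f \<in> ops free_operad n"
  shows "white_map R n f = (\<lambda>w\<in>permutations_of_set {1..n}.
    quadratic_ideal R n +>\<^bsub>component free_operad n\<^esub> word_sum f w)"
proof -
  interpret operad_quotient free_operad "quadratic_ideal R"
    by unfold_locales (rule quadratic_ideal_ideal[OF R])
  define M where "M = component (quadratic_operad R) n"
  have M: "M = component (quotient_operad free_operad (quadratic_ideal R)) n"
    by (simp add: M_def quadratic_operad_def)
  interpret Q: additive_operad "quotient_operad free_operad (quadratic_ideal R)"
    by (rule additive_quotient_operad)
  interpret T: abelian_monoid "As_tensor n M"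
    unfolding M by (rule abelian_monoid_As_tensor) (rule Q.component.abelian_group_axioms)
  define W where "W = permutations_of_set {1..n}"
  \<comment> \<open>The coefficient at \<open>w\<close> of the part of \<open>f\<close> supported on
    \<open>A\<close>; for \<open>A\<close> the full support this is
    \<open>word_sum f w\<close>.\<close>
  define s where "s A w = (\<Sum>t\<in>{t \<in> A. leaves t = w}.
    Poly_Mapping.single (V_part t) (Poly_Mapping.lookup f t))" for A :: "'g white monomial set" and w
  let ?term = "\<lambda>t. Poly_Mapping.lookup f t \<odot>\<^bsub>As_tensor n M\<^esub>
    pure_tensor n M (leaves t) (cls n (Poly_Mapping.single (V_part t) 1))"
  have keys: "Poly_Mapping.keys f \<subseteq> multilinear_monomials n"
    using f by (simp add: ops_free)
  have s: "s A w \<in> ops free_operad n" if "A \<subseteq> multilinear_monomials n" for A w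
    unfolding s_def ops_free mem_Collect_eq
    by (rule order_trans[OF keys_sum_single_subset]) (use that in \<open>auto simp: V_part_multilinear_iff\<close>)
  have single: "Poly_Mapping.single (V_part t) c \<in> ops free_operad n" if "t \<in> multilinear_monomials n" for t and c :: 'k
    using that by (simp add: ops_free V_part_multilinear_iff)
  have zero: "\<zero>\<^bsub>M\<^esub> = cls n 0"
    unfolding M zero_quotient using cls_eq_ideal_iff[of 0 n] sn_submoduleD(2)[OF operad_idealD(1)[OF ideal]]
    by (simp add: ops_free)
  have zero_ops: "(0 :: 'g monomial \<Rightarrow>\<^sub>0 'k) \<in> ops free_operad n"
    by (simp add: ops_free)
  have t: "?term t = (\<lambda>w\<in>W. cls n (if w = leaves t then Poly_Mapping.single (V_part t) (Poly_Mapping.lookup f t) else 0))"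
    if "t \<in> multilinear_monomials n" for t
    unfolding smult_As_tensor W_def[symmetric]
  proof (rule restrict_ext)
    fix w assume w: "w \<in> W"
    have "c \<odot>\<^bsub>M\<^esub> cls n (Poly_Mapping.single (V_part t) 1) = cls n (Poly_Mapping.single (V_part t) c)"
      "c \<odot>\<^bsub>M\<^esub> cls n 0 = cls n 0" for c
      using cls_smult[OF single[OF that], of c 1] cls_smult[OF zero_ops, of c] unfolding M by simp_all
    thus "Poly_Mapping.lookup f t \<odot>\<^bsub>M\<^esub> pure_tensor n M (leaves t) (cls n (Poly_Mapping.single (V_part t) 1)) w =
        cls n (if w = leaves t then Poly_Mapping.single (V_part t) (Poly_Mapping.lookup f t) else 0)"
      using w by (simp add: pure_tensor_def zero W_def del: One_nat_def)
  qed
  have carrier: "(\<lambda>w\<in>W. cls n (g w)) \<in> carrier (As_tensor n M)" if "\<And>w. g w \<in> ops free_operad n" for g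
    unfolding carrier_As_tensor W_def M by (intro restrict_PiE_iff[THEN iffD2] ballI cls_ops that)
  have "finsum (As_tensor n M) ?term A = (\<lambda>w\<in>W. cls n (s A w))" if "A \<subseteq> Poly_Mapping.keys f" for A
    using finite_subset[OF that finite_keys] that
  proof (induction A rule: finite_induct)
    case empty
    show ?case unfolding T.finsum_empty zero_As_tensor by (simp add: s_def zero W_def)
  next
    case (insert a A)
    have A: "A \<subseteq> multilinear_monomials n" "a \<in> multilinear_monomials n"
      using insert.prems keys by auto
    have "?term x \<in> carrier (As_tensor n M)" if "x \<in> multilinear_monomials n" for x
      unfolding t[OF that] by (rule carrier) (simp add: single[OF that] zero_ops)
    hence "finsum (As_tensor n M) ?term (insert a A) = ?term a \<oplus>\<^bsub>As_tensor n M\<^esub> finsum (As_tensor n M) ?term A"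
      using insert.hyps A by (intro T.finsum_insert) auto
    also have "\<dots> = (\<lambda>w\<in>W. cls n (if w = leaves a then Poly_Mapping.single (V_part a) (Poly_Mapping.lookup f a) else 0) \<oplus>\<^bsub>M\<^esub> cls n (s A w))"
      unfolding insert.IH[OF insert_subset[THEN iffD1, OF insert.prems, THEN conjunct2]] t[OF A(2)] add_As_tensor W_def
      by (rule restrict_ext) (simp del: One_nat_def)
    also have "\<dots> = (\<lambda>w\<in>W. cls n (s (insert a A) w))"
    proof (rule restrict_ext)
      fix w
      have "{t \<in> insert a A. leaves t = w} = (if w = leaves a then insert a {t \<in> A. leaves t = w} else {t \<in> A. leaves t = w})"
        by auto
      hence eq: "s (insert a A) w = (if w = leaves a then Poly_Mapping.single (V_part a) (Poly_Mapping.lookup f a) else 0) + s A w"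
        using insert.hyps by (simp add: s_def)
      thus "cls n (if w = leaves a then Poly_Mapping.single (V_part a) (Poly_Mapping.lookup f a) else 0) \<oplus>\<^bsub>M\<^esub> cls n (s A w) =
          cls n (s (insert a A) w)"
        unfolding M eq using single[OF A(2)] zero_ops s[OF A(1), of w]
        by (intro cls_add[unfolded add_free]) simp_all
    qed
    finally show ?case .
  qed
  from this[of "Poly_Mapping.keys f"] show ?thesis
    unfolding white_map_def Let_def M_def[symmetric] s_def word_sum_def W_def by simp
qed

text \<open>The kernel decouples into one condition per word, and each class vanishes exactly on
  \<open>R\<close>, because the ideal generated by \<open>R\<close> is just \<open>R\<close> in
  arity 3.\<close>

lemma white_relations_iff:
  fixes R :: "('g monomial \<Rightarrow>\<^sub>0 'k::field) set"
  assumes R: "sn_submodule free_operad 3 R"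
  shows "f \<in> white_relations R \<longleftrightarrow>
    f \<in> ops free_operad 3 \<and> (\<forall>w\<in>permutations_of_set {1..3}. word_sum f w \<in> R)"
proof (cases "f \<in> ops free_operad 3")
  case True
  note R' = sn_submoduleD(1)[OF R]
  interpret operad_quotient free_operad "quadratic_ideal R"
    by unfold_locales (rule quadratic_ideal_ideal[OF R'])
  have ops: "word_sum f w \<in> ops free_operad 3" for w
    unfolding ops_free mem_Collect_eq
    by (rule order_trans[OF keys_word_sum]) (use True in \<open>auto simp: V_part_multilinear_iff ops_free\<close>)
  have eq: "restrict u A = restrict v A \<longleftrightarrow> (\<forall>w\<in>A. u w = v w)" for u v :: "nat list \<Rightarrow> ('g monomial \<Rightarrow>\<^sub>0 'k) set" and A
    by (auto simp: restrict_def fun_eq_iff)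
  have zero: "\<zero>\<^bsub>As_tensor 3 (component (quadratic_operad R) 3)\<^esub> =
      (\<lambda>w\<in>permutations_of_set {1..3}. quadratic_ideal R 3)"
    using zero_quotient[of 3] by (simp add: As_tensor_def quadratic_operad_def)
  have "f \<in> white_relations R \<longleftrightarrow> (\<forall>w\<in>permutations_of_set {1..3}. cls 3 (word_sum f w) = quadratic_ideal R 3)"
    using True unfolding white_relations_def zero white_map_eq[OF R' True] mem_Collect_eq eq by simp
  also have "\<dots> \<longleftrightarrow> (\<forall>w\<in>permutations_of_set {1..3}. word_sum f w \<in> R)"
    unfolding cls_eq_ideal_iff[OF ops] unfolding quadratic_ideal_3[OF R] by (rule refl)
  finally show ?thesis using True by simp
qed (simp add: white_relations_def)

lemma permutations_of_set_obtain_permutes: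
  assumes "w \<in> permutations_of_set {1..n}"
  obtains \<sigma> where "\<sigma> permutes {1..n}" "map \<sigma> [1..<Suc n] = w"
proof -
  \<comment> \<open>Variables are numbered from 1 but list positions from 0, hence
    \<open>j - 1\<close>; off \<open>{1..n}\<close> the map is the identity, as
    \<open>permutes\<close> demands.\<close>
  define \<sigma> where "\<sigma> j = (if j \<in> {1..n} then w ! (j - 1) else j)" for j
  have w: "set w = {1..n}" "distinct w" "length w = n"
    using assms distinct_card[of w] by (auto simp: permutations_of_set_def)
  have map: "map \<sigma> [1..<Suc n] = w"
    by (rule nth_equalityI) (auto simp: w(3) \<sigma>_def simp del: upt_Suc)
  have "set [1..<Suc n] = {1..n}"
    by auto
  hence image: "\<sigma> ` {1..n} = {1..n}"
    using arg_cong[OF map, of set] w(1) by (simp only: set_map)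
  hence "bij_betw \<sigma> {1..n} {1..n}"
    by (simp add: bij_betw_def eq_card_imp_inj_on)
  hence "\<sigma> permutes {1..n}"
    by (rule bij_imp_permutes) (simp only: \<sigma>_def if_False)
  thus ?thesis using map that by blast
qed

lemma sn_generated_id_plus_13:
  fixes R :: "('g monomial \<Rightarrow>\<^sub>0 'k::field) set"
  assumes R: "sn_submodule free_operad 3 R"
    and F: "F = sn_generated free_operad 3 (id_plus_13_V_tensor_V \<inter> R)"
  shows "sn_submodule free_operad 3 F" "F \<subseteq> R"
proof -
  show "sn_submodule free_operad 3 F"
    unfolding F using sn_submoduleD(1)[OF R] by (intro free.sn_generated_submodule) auto
  show "F \<subseteq> R"
    unfolding F using R by (rule sn_generated_least) simp
qed

text \<open>Permuting the variables turns a relation along the word \<open>w\<close> into one along the identity word.\<close>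

lemma lin_ext_V_part_white_relations:
  fixes R :: "('g monomial \<Rightarrow>\<^sub>0 'k::field) set"
  assumes R: "sn_submodule free_operad 3 R"
    and F: "F = sn_generated free_operad 3 (id_plus_13_V_tensor_V \<inter> R)"
    and f: "f \<in> white_relations R"
  shows "lin_ext V_part f \<in> F"
proof -
  note Fsub = sn_generated_id_plus_13[OF R F]
  have word: "word_sum f w \<in> F" if w: "w \<in> permutations_of_set {1..3}" for w
  proof -
    obtain \<sigma> where \<sigma>: "\<sigma> permutes {1..3}" "map \<sigma> [1..<Suc 3] = w"
      using w by (rule permutations_of_set_obtain_permutes)
    let ?\<tau> = "Hilbert_Choice.inv \<sigma>"
    have \<tau>: "?\<tau> permutes {1..3}"
      by (rule permutes_inv[OF \<sigma>(1)])
    \<comment> \<open>The inverse of the permutation that spells \<open>w\<close> takes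
      \<open>w\<close> back to the identity word; \<open>V_part\<close> commutes with this
      relabelling, so the support moves along.\<close>
    have "map ?\<tau> w = [1, 2, 3]"
      unfolding \<sigma>(2)[symmetric] using permutes_inverses(2)[OF \<sigma>(1)] by (simp add: upt_rec)
    hence "relabel ?\<tau> ` V_part ` {t \<in> Poly_Mapping.keys f. leaves t = w} \<subseteq> V_part ` {t. leaves t = [1, 2, 3]}"
      unfolding image_image V_part_relabel[symmetric] by (intro image_subsetI imageI) simp
    hence "Poly_Mapping.keys (lin_ext (relabel ?\<tau>) (word_sum f w)) \<subseteq> V_part ` {t. leaves t = [1, 2, 3]}"
      using keys_lin_ext[of "relabel ?\<tau>" "word_sum f w"] keys_word_sum[of f w]
      by (meson image_mono order_trans)
    moreover have "act free_operad 3 ?\<tau> (word_sum f w) \<in> R"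
      using f w \<tau> by (intro sn_submoduleD(5)[OF R]) (simp_all add: white_relations_iff[OF R])
    ultimately have "act free_operad 3 ?\<tau> (word_sum f w) \<in> F"
      unfolding F by (intro subsetD[OF sn_generated_subset]) (simp add: id_plus_13_V_tensor_V_eq act_free)
    \<comment> \<open>Acting by \<open>\<sigma>\<close> restores the component at \<open>w\<close>;
      this uses that \<open>F\<close> is closed under all permutations.\<close>
    from sn_submoduleD(5)[OF Fsub(1) this \<sigma>(1)] show ?thesis
      using permutes_inverses(1)[OF \<sigma>(1)]
      by (simp add: act_free lin_ext_lin_ext relabel_relabel lin_ext_ident)
  qed
  have "(\<Sum>w\<in>A. word_sum f w) \<in> F" if "finite A" "A \<subseteq> permutations_of_set {1..3}" for A
    using that
  proof (induction A rule: finite_induct)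
    case empty
    show ?case using sn_submoduleD(2)[OF Fsub(1)] by simp
  next
    case (insert w A)
    thus ?case using sn_submoduleD(3)[OF Fsub(1) word[of w], of "\<Sum>w\<in>A. word_sum f w"] by simp
  qed
  from this[of "permutations_of_set {1..3}"] show ?thesis
    using f by (simp add: lin_ext_V_part_eq_sum_word_sum[of f 3] white_relations_iff[OF R])
qed

text \<open>Every monomial of \<open>x\<close> is the \<open>V_part\<close> of a white monomial with
  leaf word 1, 2, 3. Choosing such preimages concentrates the lift on one word: its component there
  is \<open>x\<close>, which lies in \<open>R\<close>, and the others vanish.\<close>

lemma white_relations_lift:
  fixes R :: "('g monomial \<Rightarrow>\<^sub>0 'k::field) set"
  assumes R: "sn_submodule free_operad 3 R" and x: "x \<in> id_plus_13_V_tensor_V \<inter> R"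
  obtains f where "f \<in> white_relations R" "lin_ext V_part f = x"
proof -
  have keys: "Poly_Mapping.keys x \<subseteq> V_part ` {t. leaves t = [1, 2, 3]}"
    using x by (simp add: id_plus_13_V_tensor_V_eq)
  define s where "s u = (SOME t. leaves t = [1, 2, 3] \<and> V_part t = u)" for u :: "'g monomial"
  have s: "leaves (s u) = [1, 2, 3]" "V_part (s u) = u" if "u \<in> Poly_Mapping.keys x" for u
  proof -
    have "\<exists>t. leaves t = [1, 2, 3] \<and> V_part t = u"
      using keys that by auto
    from someI_ex[OF this] show "leaves (s u) = [1, 2, 3]" "V_part (s u) = u"
      by (simp_all only: s_def)
  qed
  define f where "f = lin_ext s x"
  have \<pi>f: "lin_ext V_part f = x"
    using lin_ext_cong[of x "\<lambda>u. V_part (s u)" "\<lambda>u. u"] s by (simp add: f_def lin_ext_lin_ext lin_ext_ident)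
  have leaves: "leaves t = [1, 2, 3]" if "t \<in> Poly_Mapping.keys f" for t
    using that keys_lin_ext[of s x] s(1) unfolding f_def by auto
  have upto: "{1..3} = {1, 2, 3 :: nat}" by auto
  have f: "f \<in> ops free_operad 3"
    unfolding ops_free using leaves by (auto simp: multilinear_monomials_iff upto)
  have "word_sum f w \<in> R" for w
  proof (cases "w = [1, 2, 3]")
    case True
    hence "{t \<in> Poly_Mapping.keys f. leaves t = w} = Poly_Mapping.keys f"
      using leaves by auto
    hence "word_sum f w = x"
      using \<pi>f by (simp add: word_sum_def lin_ext_def)
    thus ?thesis using x by simp
  next
    case False
    hence "{t \<in> Poly_Mapping.keys f. leaves t = w} = {}"
      using leaves by auto
    hence "word_sum f w = 0"
      by (simp only: word_sum_def sum.empty)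
    thus ?thesis
      using sn_submoduleD(2)[OF R] by simp
  qed
  with f have "f \<in> white_relations R"
    by (simp add: white_relations_iff[OF R])
  thus ?thesis using \<pi>f that by blast
qed


section \<open>The identification of the two white operations\<close>

lemma bilin_ext_diff_left: "bilin_ext G (x - x') y = bilin_ext G x y - bilin_ext G x' y"
  using bilin_ext_add_left[of G "x - x'" x' y] by (simp add: algebra_simps)

lemma bilin_ext_diff_right: "bilin_ext G x (y - y') = bilin_ext G x y - bilin_ext G x y'"
  using bilin_ext_add_right[of G x "y - y'" y'] by (simp add: algebra_simps)

lemma pm_smult_diff: "pm_smult c (x - y) = pm_smult c x - pm_smult c y"
  by (rule poly_mapping_eqI) (simp add: lookup_minus right_diff_distrib)

text \<open>The elements congruent to their normal form without \<open>\<succ>\<close> form a suboperad containing the generators.\<close>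

lemma V_part_congruence:
  fixes I :: "nat \<Rightarrow> ('g white monomial \<Rightarrow>\<^sub>0 'k::field) set"
  assumes I: "operad_ideal free_operad I" and ident: "nonsym_identifications \<subseteq> I 2"
    and x: "x \<in> ops free_operad n"
  shows "x - lin_ext (map_monomial Prec) (lin_ext V_part x) \<in> I n"
proof -
  define e :: "('g white monomial \<Rightarrow>\<^sub>0 'k) \<Rightarrow> 'g white monomial \<Rightarrow>\<^sub>0 'k"
    where "e x = lin_ext (map_monomial Prec) (lin_ext V_part x)" for x
  have e: "operad_hom free_operad free_operad (\<lambda>n. e)"
    unfolding e_def by (rule operad_hom_compose[OF operad_hom_V_part operad_hom_map_monomial])
  have e_single: "e (Poly_Mapping.single t c) = Poly_Mapping.single (map_monomial Prec (V_part t)) c" for t c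
    by (simp add: e_def)
  note I_sub = sn_submoduleD[OF operad_idealD(1)[OF I], unfolded zero_free add_free smult_free]
  define K where "K n = {x \<in> ops free_operad n. x - e x \<in> I n}" for n
  have add: "x + y \<in> K n" if "x \<in> K n" "y \<in> K n" for x y n
  proof -
    have eq: "(x + y) - e (x + y) = (x - e x) + (y - e y)"
      using operad_homD(2)[OF e, of x n y] that by (simp add: K_def)
    have ops: "x + y \<in> ops free_operad n"
      using that free.component.M.a_closed[of x n y] by (simp add: K_def)
    show ?thesis
      unfolding K_def mem_Collect_eq eq by (intro conjI ops I_sub(3)) (use that in \<open>simp_all add: K_def\<close>)
  qed
  have smult: "pm_smult c x \<in> K n" if "x \<in> K n" for c x n
  proof -
    have eq: "pm_smult c x - e (pm_smult c x) = pm_smult c (x - e x)"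
      using operad_homD(3)[OF e, of x n c] that by (simp add: K_def pm_smult_diff)
    have ops: "pm_smult c x \<in> ops free_operad n"
      using that free.component.smult_closed[of c x n] by (simp add: K_def)
    show ?thesis
      unfolding K_def mem_Collect_eq eq by (intro conjI ops I_sub(4)) (use that in \<open>simp_all add: K_def\<close>)
  qed
  have act: "act free_operad n \<sigma> x \<in> K n" if "x \<in> K n" "\<sigma> permutes {1..n}" for \<sigma> x n
  proof -
    have "act free_operad n \<sigma> x - e (act free_operad n \<sigma> x) = act free_operad n \<sigma> (x - e x)"
      using operad_homD(4)[OF e, of x n \<sigma>] that by (simp add: K_def act_free lin_ext_diff)
    thus ?thesis
      using that I_sub(5) free.act_closed[of \<sigma> n x] by (simp add: K_def)
  qed
  have sub: "sn_submodule free_operad n (K n)" for n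
  proof (rule sn_submoduleI[OF free.additive_operad_axioms])
    show "\<zero>\<^bsub>component free_operad n\<^esub> \<in> K n"
      using I_sub(2)[of n] by (simp add: K_def ops_free e_def)
  qed (simp_all add: add smult act, simp add: K_def)
  have unit: "Poly_Mapping.single (Var 1) 1 \<in> K 1"
    using free.unit_closed I_sub(2)[of 1] by (simp add: K_def unit_free e_single)
  have generator: "Poly_Mapping.single (Op g (Var 1) (Var 2)) 1 \<in> K 2" for g
  proof (cases g)
    case (Prec h)
    thus ?thesis
      using I_sub(2)[of 2] by (simp add: K_def ops_free e_single multilinear_monomials_2)
  next
    case (Succ h)
    \<comment> \<open>The normal form of \<open>x_1 \<succ> x_2\<close> is
      \<open>x_2 \<prec> x_1\<close>, so the required difference is one of the
      identifications.\<close>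
    have "Poly_Mapping.single (Op (Succ h) (Var 1) (Var 2)) 1
        - Poly_Mapping.single (Op (Prec h) (Var 2) (Var 1)) 1 \<in> I 2"
      using ident unfolding nonsym_identifications_def by blast
    thus ?thesis
      unfolding Succ by (simp add: K_def ops_free e_single multilinear_monomials_2)
  qed
  have pcomp: "pcomp free_operad m n i x y \<in> K (m + n - 1)"
    if i: "i \<in> {1..m}" and xy: "x \<in> K m" "y \<in> K n" for m n i x y
  proof -
    have x: "x \<in> ops free_operad m" "x - e x \<in> I m" and y: "y \<in> ops free_operad n" "y - e y \<in> I n"
      using xy by (simp_all add: K_def)
    \<comment> \<open>The usual telescoping of a difference of products:
      \<open>xy - e(x)e(y) = (x - e(x))y + e(x)(y - e(y))\<close>, with each term in the
      ideal.\<close>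
    have "pcomp free_operad m n i x y - e (pcomp free_operad m n i x y) =
        pcomp free_operad m n i (x - e x) y + pcomp free_operad m n i (e x) (y - e y)"
      unfolding operad_homD(6)[OF e i x(1) y(1)]
      by (simp add: pcomp_free bilin_ext_diff_left bilin_ext_diff_right)
    moreover have "pcomp free_operad m n i (x - e x) y \<in> I (m + n - 1)"
      by (rule operad_idealD(2)[OF I i x(2) y(1)])
    moreover have "pcomp free_operad m n i (e x) (y - e y) \<in> I (m + n - 1)"
      by (rule operad_idealD(3)[OF I i operad_homD(1)[OF e x(1)] y(2)])
    ultimately show ?thesis
      using I_sub(3) free.pcomp_closed[OF i x(1) y(1)] by (simp add: K_def)
  qed
  have "x \<in> K n"
    by (rule free_operad_generated[of K, OF sub unit generator pcomp x])
  thus ?thesis by (simp add: K_def e_def)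
qed


lemma nonsym_identifications_ops: "nonsym_identifications \<subseteq> ops free_operad 2"
proof
  fix x :: "'g white monomial \<Rightarrow>\<^sub>0 'k::field"
  assume "x \<in> nonsym_identifications"
  then obtain a b where x: "x = Poly_Mapping.single a 1 - Poly_Mapping.single b 1"
    and ab: "a \<in> multilinear_monomials 2" "b \<in> multilinear_monomials 2"
    unfolding nonsym_identifications_def multilinear_monomials_2 by blast
  have "Poly_Mapping.single a 1 \<in> ops free_operad 2" "Poly_Mapping.single b 1 \<in> ops free_operad 2"
    using ab by (simp_all add: ops_free)
  from free.component.M.minus_closed[OF this] show "x \<in> ops free_operad 2"
    unfolding x free_minus[OF \<open>Poly_Mapping.single b 1 \<in> ops free_operad 2\<close>] .
qed

lemma lin_ext_V_part_nonsym_identifications: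
  "x \<in> nonsym_identifications \<Longrightarrow> lin_ext V_part x = 0"
  unfolding nonsym_identifications_def by (auto simp: lin_ext_diff)

section \<open>The white product modulo the identifications is P(V,F)\<close>

locale nonsym_setup =
  fixes R F :: "('g monomial \<Rightarrow>\<^sub>0 'k::field) set"
  assumes R: "sn_submodule free_operad 3 R"
    and F: "F = sn_generated free_operad 3 (id_plus_13_V_tensor_V \<inter> R)"
begin

lemma white_relations_ops: "white_relations R \<subseteq> ops free_operad 3"
  by (auto simp: white_relations_def)

lemma F_submodule: "sn_submodule free_operad 3 F"
  and F_subset: "F \<subseteq> R"
  by (rule sn_generated_id_plus_13[OF R F])+

sublocale W: operad_quotient free_operad "quadratic_ideal (white_relations R)"
  by unfold_locales (rule quadratic_ideal_ideal[OF white_relations_ops])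

sublocale Q: operad_quotient free_operad "quadratic_ideal F"
  by unfold_locales (rule quadratic_ideal_ideal[OF sn_submoduleD(1)[OF F_submodule]])

lemma As_white_product_eq:
  "As_white_product R = quotient_operad free_operad (quadratic_ideal (white_relations R))"
  by (simp add: As_white_product_def quadratic_operad_def)

lemma nonsym_ideal_ideal: "operad_ideal (As_white_product R) (nonsym_ideal R)"
  unfolding nonsym_ideal_def As_white_product_eq
proof (rule additive_operad.ideal_generated_ideal[OF W.additive_quotient_operad])
  show "(if m = 2 then W.cls 2 ` nonsym_identifications else {}) \<subseteq>
      ops (quotient_operad free_operad (quadratic_ideal (white_relations R))) m" for m
    using nonsym_identifications_ops W.cls_ops by auto
qed

text \<open>The white product is already a quotient of the free operad, so elements of the new
  quotient are cosets of cosets.\<close>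

sublocale N: operad_quotient "As_white_product R" "nonsym_ideal R"
  unfolding operad_quotient_def operad_quotient_axioms_def
  using W.additive_quotient_operad nonsym_ideal_ideal by (simp add: As_white_product_eq)

definition to_quotient :: "nat \<Rightarrow> ('g white monomial \<Rightarrow>\<^sub>0 'k) \<Rightarrow> ('g monomial \<Rightarrow>\<^sub>0 'k) set" where
  "to_quotient n x = Q.cls n (lin_ext V_part x)"

lemma operad_hom_to_quotient: "operad_hom free_operad (quadratic_operad F) to_quotient"
  unfolding to_quotient_def quadratic_operad_def
  by (rule operad_hom_compose[OF operad_hom_V_part Q.operad_hom_cls])

lemma additive_quadratic_operad: "additive_operad (quadratic_operad F)"
  unfolding quadratic_operad_def by (rule Q.additive_quotient_operad)

lemma zero_quadratic_operad: "\<zero>\<^bsub>component (quadratic_operad F) n\<^esub> = quadratic_ideal F n"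
  unfolding quadratic_operad_def by (rule Q.zero_quotient)

lemma to_quotient_eq_zero_iff:
  assumes "x \<in> ops free_operad n"
  shows "to_quotient n x = \<zero>\<^bsub>component (quadratic_operad F) n\<^esub> \<longleftrightarrow> lin_ext V_part x \<in> quadratic_ideal F n"
  unfolding to_quotient_def zero_quadratic_operad
  by (rule Q.cls_eq_ideal_iff[OF operad_homD(1)[OF operad_hom_V_part assms]])

text \<open>The kernel is an ideal, so only the white relations themselves matter, and
  \<open>V_part\<close> sends these into \<open>F\<close>.\<close>

lemma to_quotient_ideal:
  assumes "x \<in> quadratic_ideal (white_relations R) n"
  shows "to_quotient n x = \<zero>\<^bsub>component (quadratic_operad F) n\<^esub>"
proof -
  let ?K = "\<lambda>n. {x \<in> ops free_operad n. to_quotient n x \<in> {\<zero>\<^bsub>component (quadratic_operad F) n\<^esub>}}"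
  have "operad_ideal free_operad ?K"
    by (rule operad_ideal_vimage[OF operad_hom_to_quotient free.additive_operad_axioms additive_quadratic_operad
          additive_operad.operad_ideal_zero[OF additive_quadratic_operad]])
  moreover have "white_relations R \<subseteq> ?K 3"
  proof
    fix f assume f: "f \<in> white_relations R"
    hence "lin_ext V_part f \<in> quadratic_ideal F 3"
      using lin_ext_V_part_white_relations[OF R F] quadratic_ideal_subset by blast
    thus "f \<in> ?K 3"
      using f white_relations_ops to_quotient_eq_zero_iff[of f 3] by blast
  qed
  ultimately have "quadratic_ideal (white_relations R) n \<subseteq> ?K n"
    by (rule quadratic_ideal_least)
  thus ?thesis using assms by blast
qed

definition from_white :: "nat \<Rightarrow> ('g white monomial \<Rightarrow>\<^sub>0 'k) set \<Rightarrow> ('g monomial \<Rightarrow>\<^sub>0 'k) set" where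
  "from_white = W.induced to_quotient"

lemma from_white_cls: "x \<in> ops free_operad n \<Longrightarrow> from_white n (W.cls n x) = to_quotient n x"
  unfolding from_white_def
  by (rule W.induced_cls[OF operad_hom_to_quotient additive_quadratic_operad to_quotient_ideal])

lemma operad_hom_from_white: "operad_hom (As_white_product R) (quadratic_operad F) from_white"
  unfolding from_white_def As_white_product_eq
  by (rule W.operad_hom_induced[OF operad_hom_to_quotient additive_quadratic_operad to_quotient_ideal])

lemma white_ops: "ops (As_white_product R) n = W.cls n ` ops free_operad n"
  unfolding As_white_product_eq by (rule W.quotient_ops)

lemma from_white_surj: "from_white n ` ops (As_white_product R) n = ops (quadratic_operad F) n"
proof -
  have "from_white n ` ops (As_white_product R) n = to_quotient n ` ops free_operad n"
    unfolding white_ops image_image by (rule image_cong) (simp_all add: from_white_cls)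
  also have "\<dots> = Q.cls n ` lin_ext V_part ` ops free_operad n"
    by (simp add: to_quotient_def image_image)
  also have "lin_ext V_part ` ops free_operad n = (ops free_operad n :: ('g monomial \<Rightarrow>\<^sub>0 'k) set)"
  proof (intro equalityI subsetI)
    fix x :: "'g monomial \<Rightarrow>\<^sub>0 'k" assume "x \<in> ops free_operad n"
    hence "lin_ext (map_monomial Prec) x \<in> ops free_operad n"
      by (rule operad_homD(1)[OF operad_hom_map_monomial])
    thus "x \<in> lin_ext V_part ` ops free_operad n"
      by (rule image_eqI[rotated]) (simp add: lin_ext_V_part_Prec)
  next
    fix x :: "'g monomial \<Rightarrow>\<^sub>0 'k" assume "x \<in> lin_ext V_part ` ops free_operad n"
    thus "x \<in> ops free_operad n"
      using operad_homD(1)[OF operad_hom_V_part] by blast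
  qed
  finally show ?thesis
    unfolding quadratic_operad_def Q.quotient_ops .
qed

text \<open>\<open>V_part\<close> sends both terms of an identification to the same monomial, so the
  generators lie in the kernel, which is an ideal.\<close>

lemma nonsym_ideal_subset_kernel:
  "nonsym_ideal R n \<subseteq>
    {A \<in> ops (As_white_product R) n. from_white n A = \<zero>\<^bsub>component (quadratic_operad F) n\<^esub>}"
proof -
  let ?K = "\<lambda>n. {A \<in> ops (As_white_product R) n. from_white n A \<in> {\<zero>\<^bsub>component (quadratic_operad F) n\<^esub>}}"
  have K: "operad_ideal (As_white_product R) ?K"
    by (rule operad_ideal_vimage[OF operad_hom_from_white N.additive_operad_axioms additive_quadratic_operad
          additive_operad.operad_ideal_zero[OF additive_quadratic_operad]])
  have mem: "W.cls 2 x \<in> ?K 2" if "x \<in> nonsym_identifications" for x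
  proof -
    have x: "x \<in> ops free_operad 2"
      using that nonsym_identifications_ops by blast
    have "lin_ext V_part x \<in> quadratic_ideal F 2"
      using sn_submoduleD(2)[OF operad_idealD(1)[OF Q.ideal, of 2]]
      by (simp add: lin_ext_V_part_nonsym_identifications[OF that])
    thus ?thesis
      using x by (simp add: white_ops from_white_cls to_quotient_eq_zero_iff)
  qed
  have "(if m = 2 then W.cls 2 ` nonsym_identifications else {}) \<subseteq> ?K m" for m
  proof (cases "m = 2")
    case True
    have "W.cls 2 ` nonsym_identifications \<subseteq> ?K 2"
      by (rule image_subsetI) (rule mem)
    thus ?thesis
      unfolding True by (simp only: simp_thms if_True)
  next
    case False
    thus ?thesis
      by (simp only: if_False empty_subsetI)
  qed
  with K have "nonsym_ideal R n \<subseteq> ?K n"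
    unfolding nonsym_ideal_def by (rule ideal_generated_least)
  thus ?thesis by blast
qed

text \<open>Modulo the identifications, \<open>a\<close> agrees with its normal form without
  \<open>\<succ>\<close>. It remains to see that this form vanishes. The section pulls the ideal
  back to an ideal, which contains the generators of \<open>F\<close>: each lifts to a white
  relation with the same normal form.\<close>

lemma kernel_subset_nonsym_ideal:
  assumes a: "a \<in> ops free_operad n" and ker: "lin_ext V_part a \<in> quadratic_ideal F n"
  shows "W.cls n a \<in> nonsym_ideal R n"
proof -
  \<comment> \<open>Pulling back to the free operad replaces the two successive quotients by one
    ideal, which contains both the identifications and the white relations.\<close>
  define I where "I n = {x \<in> ops free_operad n. W.cls n x \<in> nonsym_ideal R n}" for n
  have I: "operad_ideal free_operad I"
    unfolding I_def
    by (rule operad_ideal_vimage[OF W.operad_hom_cls free.additive_operad_axioms W.additive_quotient_operad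
          nonsym_ideal_ideal[unfolded As_white_product_eq]])
  note I_add = sn_submoduleD(3)[OF operad_idealD(1)[OF I], unfolded add_free]
  have "W.cls 2 ` nonsym_identifications \<subseteq> nonsym_ideal R 2"
    using ideal_generated_subset[of "\<lambda>n. if n = 2 then W.cls 2 ` nonsym_identifications else {}" 2
        "As_white_product R"]
    unfolding nonsym_ideal_def by (simp only: simp_thms if_True)
  hence ident: "nonsym_identifications \<subseteq> I 2"
    unfolding I_def using nonsym_identifications_ops by blast
  have white: "f \<in> I 3" if "f \<in> white_relations R" for f
  proof -
    have "W.cls 3 f = \<zero>\<^bsub>component (As_white_product R) 3\<^esub>"
      unfolding As_white_product_eq W.zero_quotient
      using that white_relations_ops quadratic_ideal_subset by (subst W.cls_eq_ideal_iff) auto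
    thus ?thesis
      using sn_submoduleD(2)[OF operad_idealD(1)[OF nonsym_ideal_ideal, of 3]] that white_relations_ops
      by (auto simp: I_def)
  qed
  let ?\<iota> = "lin_ext (map_monomial Prec)"
  let ?J = "\<lambda>n. {x \<in> ops free_operad n. ?\<iota> x \<in> I n}"
  have J: "operad_ideal free_operad ?J"
    by (rule operad_ideal_vimage[OF operad_hom_map_monomial free.additive_operad_axioms
          free.additive_operad_axioms I])
  have "F \<subseteq> ?J 3"
    unfolding F
  proof (rule sn_generated_least[OF operad_idealD(1)[OF J]], rule subsetI)
    fix x assume x: "x \<in> id_plus_13_V_tensor_V \<inter> R"
    obtain f where f: "f \<in> white_relations R" "lin_ext V_part f = x"
      using R x by (rule white_relations_lift)
    have f_ops: "f \<in> ops free_operad 3"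
      using f(1) white_relations_ops by blast
    \<comment> \<open>Since \<open>f\<close> lifts \<open>x\<close>, its normal form is the image of
      \<open>x\<close> under the section. As \<open>f\<close> itself is in the ideal, so is that
      image.\<close>
    have "f - ?\<iota> x \<in> I 3"
      using V_part_congruence[OF I ident f_ops] by (simp add: f(2))
    from sn_submoduleD(4)[OF operad_idealD(1)[OF I] this, of "- 1"] have "?\<iota> x - f \<in> I 3"
      by (rule back_subst[of "\<lambda>y. y \<in> I 3"]) (auto intro!: poly_mapping_eqI simp: lookup_minus)
    from I_add[OF this white[OF f(1)]] have "?\<iota> x \<in> I 3"
      by simp
    thus "x \<in> ?J 3"
      using x sn_submoduleD(1)[OF R] by blast
  qed
  from quadratic_ideal_least[OF J this] ker have "?\<iota> (lin_ext V_part a) \<in> I n"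
    by blast
  from I_add[OF V_part_congruence[OF I ident a] this] have "a \<in> I n"
    by simp
  thus ?thesis by (simp add: I_def)
qed

theorem nonsym_quotient_iso: "quotient_operad (As_white_product R) (nonsym_ideal R) \<cong>\<^sub>o\<^sub>p quadratic_operad F"
proof (rule N.quotient_operad_iso[OF operad_hom_from_white additive_quadratic_operad _ from_white_surj])
  show "nonsym_ideal R n =
      {A \<in> ops (As_white_product R) n. from_white n A = \<zero>\<^bsub>component (quadratic_operad F) n\<^esub>}" for n
  proof (intro equalityI nonsym_ideal_subset_kernel subsetI)
    fix A assume "A \<in> {A \<in> ops (As_white_product R) n. from_white n A = \<zero>\<^bsub>component (quadratic_operad F) n\<^esub>}"
    then obtain a where a: "a \<in> ops free_operad n" "A = W.cls n a"
      and "from_white n (W.cls n a) = \<zero>\<^bsub>component (quadratic_operad F) n\<^esub>"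
      unfolding white_ops by blast
    thus "A \<in> nonsym_ideal R n"
      using kernel_subset_nonsym_ideal[OF a(1)] by (simp add: from_white_cls to_quotient_eq_zero_iff)
  qed
qed

end


section \<open>Dimensions\<close>

text \<open>To read off \<open>dim\<close>, a finite basis of \<open>N\<close> must be at hand.
  Independent subsets of \<open>N\<close> stay independent in \<open>V\<close>, which bounds their
  size, and a maximal one is a basis. Dimension 0 makes it empty, and the empty set spans only
  zero.\<close>

lemma (in vectorspace) subspace_dim_0:
  assumes "fin_dim" and N: "VectorSpace.subspace K N V" and "vectorspace.dim K (vs N) = 0"
  shows "N = {\<zero>\<^bsub>V\<^esub>}"
proof -
  interpret N: vectorspace K "vs N"
    by (rule subspace_is_vs[OF N])
  have sub: "LinearCombinations.submodule K N V"
    using N by (rule is_module)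
  have bound: "finite S \<and> card S \<le> dim" if "S \<subseteq> carrier (vs N) \<and> N.lin_indpt S" for S
  proof -
    have "S \<subseteq> N" "lin_indpt S"
      using that span_li_not_depend(2)[OF _ sub, of S] by simp_all
    moreover have "N \<subseteq> carrier V"
      using sub by (rule LinearCombinations.submodule.subset)
    ultimately show ?thesis
      using li_le_dim[OF assms(1), of S] by blast
  qed
  have empty: "{} \<subseteq> carrier (vs N) \<and> N.lin_indpt {}"
    by (simp add: N.lin_dep_def)
  have "\<exists>A. finite A \<and> maximal A (\<lambda>S. S \<subseteq> carrier (vs N) \<and> N.lin_indpt S)"
    by (rule maximal_exists[where P = "\<lambda>S. S \<subseteq> carrier (vs N) \<and> N.lin_indpt S", OF bound empty])
  then obtain A where A: "finite A" "maximal A (\<lambda>S. S \<subseteq> carrier (vs N) \<and> N.lin_indpt S)"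
    by (elim exE conjE)
  have "N.basis A"
    using A(2) by (rule N.max_li_is_basis)
  moreover from N.dim_basis[OF A(1) this] have "A = {}"
    using A(1) assms(3) by simp
  ultimately show ?thesis
    by (simp add: N.basis_def N.span_empty)
qed

text \<open>By rank and nullity, a surjection between spaces of equal finite dimension leaves
  dimension 0 for the kernel.\<close>

lemma (in linear_map) surj_dim_eq_imp_ker:
  assumes "V.fin_dim" "T ` carrier V = carrier W" "V.dim = W.dim"
  shows "kerT = {\<zero>\<^bsub>V\<^esub>}"
proof (rule V.subspace_dim_0[OF assms(1) kerT_is_subspace])
  have "vectorspace.dim K (W.vs imT) = W.dim"
    using surj_imp_imT_carrier[OF assms(2)] by simp
  thus "vectorspace.dim K (V.vs kerT) = 0"
    using rank_nullity[OF assms(1)] assms(3) by simp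
qed

lemma (in additive_operad) component_vectorspace: "vectorspace class_ring (component P n)"
  using component_module class_field by (simp add: vectorspace_def)

lemma operad_hom_linear_map:
  assumes "operad_hom P Q \<phi>" "additive_operad P" "additive_operad Q"
  shows "linear_map class_ring (component P n) (component Q n) (\<phi> n)"
  using assms by (simp add: linear_map_def additive_operad.component_vectorspace operad_hom_mod_hom)

abbreviation op_fin_dim :: "('k::field, 'a) operad \<Rightarrow> nat \<Rightarrow> bool" where
  "op_fin_dim P n \<equiv> vectorspace.fin_dim class_ring (component P n)"

lemma (in operad_quotient) fin_dim_quotient:
  assumes "op_fin_dim P n"
  shows "op_fin_dim (quotient_operad P I) n"
  using linear_map.surj_fin_dim[OF operad_hom_linear_map[OF operad_hom_cls additive_operad_axioms
      additive_quotient_operad] assms quotient_ops[symmetric]] .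

text \<open>Comparing dimensions requires finite dimension in arity 3. This comes from the two
  bracketings with finitely many labels on nodes and leaves.\<close>

lemma finite_multilinear_monomials_3:
  assumes "finite (UNIV :: 'g set)"
  shows "finite (multilinear_monomials 3 :: 'g monomial set)"
proof -
  let ?X = "(UNIV :: 'g set) \<times> (UNIV :: 'g set) \<times> {1..3::nat} \<times> {1..3::nat} \<times> {1..3::nat}"
  have "multilinear_monomials 3 \<subseteq>
      (\<lambda>(g, h, i, j, k). Op g (Op h (Var i) (Var j)) (Var k)) ` ?X \<union>
      (\<lambda>(g, h, i, j, k). Op g (Var i) (Op h (Var j) (Var k))) ` ?X"
  proof
    fix t :: "'g monomial" assume t: "t \<in> multilinear_monomials 3"
    hence "length (leaves t) = 3"
      using distinct_card[of "leaves t"] by (simp add: multilinear_monomials_iff)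
    then obtain i j k where ijk: "leaves t = [i, j, k]"
      by (auto simp: numeral_3_eq_3 length_Suc_conv)
    have "i \<in> {1..3}" "j \<in> {1..3}" "k \<in> {1..3}"
      using t unfolding multilinear_monomials_iff ijk by auto
    from ijk show "t \<in> (\<lambda>(g, h, i, j, k). Op g (Op h (Var i) (Var j)) (Var k)) ` ?X \<union>
      (\<lambda>(g, h, i, j, k). Op g (Var i) (Op h (Var j) (Var k))) ` ?X"
    proof (cases rule: leaves_tripleE)
      case (left g h)
      thus ?thesis
        using \<open>i \<in> {1..3}\<close> \<open>j \<in> {1..3}\<close> \<open>k \<in> {1..3}\<close>
        by (intro UnI1 image_eqI[of _ _ "(g, h, i, j, k)"]) simp_all
    next
      case (right g h)
      thus ?thesis
        using \<open>i \<in> {1..3}\<close> \<open>j \<in> {1..3}\<close> \<open>k \<in> {1..3}\<close>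
        by (intro UnI2 image_eqI[of _ _ "(g, h, i, j, k)"]) simp_all
    qed
  qed
  moreover have "finite ?X"
    using assms by simp
  ultimately show ?thesis
    by (meson finite_UnI finite_imageI finite_subset)
qed

lemma op_fin_dim_free_3:
  assumes "finite (UNIV :: 'g set)"
  shows "op_fin_dim (free_operad :: ('k::field, 'g monomial \<Rightarrow>\<^sub>0 'k) operad) 3"
proof -
  let ?F = "free_operad :: ('k, 'g monomial \<Rightarrow>\<^sub>0 'k) operad"
  let ?S = "(\<lambda>t. Poly_Mapping.single t 1) ` (multilinear_monomials 3 :: 'g monomial set) :: ('g monomial \<Rightarrow>\<^sub>0 'k) set"
  have S: "?S \<subseteq> ops ?F 3"
    by (auto simp: ops_free)
  have "ops ?F 3 \<subseteq> free.component.span 3 ?S"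
  proof
    fix f assume f: "f \<in> ops ?F 3"
    show "f \<in> free.component.span 3 ?S"
    proof (rule submodule_free_memI[OF free.component.span_is_submodule[OF S]])
      fix t assume "t \<in> Poly_Mapping.keys f"
      hence "Poly_Mapping.single t 1 \<in> ?S"
        using f by (auto simp: ops_free)
      thus "Poly_Mapping.single t 1 \<in> free.component.span 3 ?S"
        using free.component.in_own_span[OF S] by blast
    qed
  qed
  hence "free.component.span 3 ?S = ops ?F 3"
    using free.component.span_is_subset2[OF S] by blast
  thus ?thesis
    unfolding vectorspace.fin_dim_def[OF free.component_vectorspace]
    using S finite_multilinear_monomials_3[OF assms] by blast
qed

lemma operad_iso_op_dim_eq:
  assumes "P \<cong>\<^sub>o\<^sub>p Q" "additive_operad P" "additive_operad Q" "op_fin_dim P n"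
  shows "op_dim P n = op_dim Q n"
proof -
  obtain \<phi> where \<phi>: "operad_hom P Q \<phi>" "bij_betw (\<phi> n) (ops P n) (ops Q n)"
    using assms(1) unfolding operad_iso_iff_bij_hom by blast
  show ?thesis
    using linear_map.dim_eq[OF operad_hom_linear_map[OF \<phi>(1) assms(2,3)] assms(4)] \<phi>(2)
    by (simp add: bij_betw_def)
qed

text \<open>As \<open>F \<subseteq> R\<close>, the class map for \<open>R\<close> factors through
  P(V,F). In arity 3 this gives a surjection with kernel \<open>R\<close> modulo \<open>F\<close>;
  equal finite dimensions make the kernel zero.\<close>

lemma op_dim_quadratic_operad_eq_imp_eq:
  fixes F R :: "('g monomial \<Rightarrow>\<^sub>0 'k::field) set"
  assumes F: "sn_submodule free_operad 3 F" and R: "sn_submodule free_operad 3 R" and "F \<subseteq> R"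
    and "op_fin_dim (quadratic_operad F) 3"
    and "op_dim (quadratic_operad R) 3 = op_dim (quadratic_operad F) 3"
  shows "F = R"
proof -
  interpret F: operad_quotient free_operad "quadratic_ideal F"
    by unfold_locales (rule quadratic_ideal_ideal[OF sn_submoduleD(1)[OF F]])
  interpret R: operad_quotient free_operad "quadratic_ideal R"
    by unfold_locales (rule quadratic_ideal_ideal[OF sn_submoduleD(1)[OF R]])
  have sub: "quadratic_ideal F n \<subseteq> quadratic_ideal R n" for n
    using R.ideal assms(3) quadratic_ideal_subset by (intro quadratic_ideal_least) auto
  have ker: "R.cls n x = \<zero>\<^bsub>component (quotient_operad free_operad (quadratic_ideal R)) n\<^esub>"
    if "x \<in> quadratic_ideal F n" for n x
    using that sub[of n] R.ideal_ops[of x n] unfolding R.zero_quotient by (subst R.cls_eq_ideal_iff) auto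
  note induced = F.induced_cls[OF R.operad_hom_cls R.additive_quotient_operad ker]
  interpret linear_map class_ring "component (quotient_operad free_operad (quadratic_ideal F)) 3"
    "component (quotient_operad free_operad (quadratic_ideal R)) 3" "F.induced R.cls 3"
    by (rule operad_hom_linear_map[OF F.operad_hom_induced[OF R.operad_hom_cls R.additive_quotient_operad ker]
          F.additive_quotient_operad R.additive_quotient_operad])
  have "F.induced R.cls 3 ` ops (quotient_operad free_operad (quadratic_ideal F)) 3 =
      ops (quotient_operad free_operad (quadratic_ideal R)) 3"
    unfolding F.quotient_ops R.quotient_ops image_image by (rule image_cong) (simp_all add: induced)
  hence kerT: "kerT = {quadratic_ideal F 3}"
    using assms(4,5) surj_dim_eq_imp_ker unfolding quadratic_operad_def F.zero_quotient by simp
  have "x \<in> F" if "x \<in> R" for x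
  proof -
    have x: "x \<in> ops free_operad 3"
      using that sn_submoduleD(1)[OF R] by blast
    have "R.cls 3 x = quadratic_ideal R 3"
      unfolding R.cls_eq_ideal_iff[OF x] using that quadratic_ideal_subset by blast
    hence "F.cls 3 x \<in> kerT"
      unfolding ker_def mem_Collect_eq R.zero_quotient by (simp add: induced[OF _ x] F.cls_ops[OF x])
    hence "x \<in> quadratic_ideal F 3"
      unfolding kerT singleton_iff F.cls_eq_ideal_iff[OF x] .
    thus ?thesis
      unfolding quadratic_ideal_3[OF F] .
  qed
  thus ?thesis using assms(3) by blast
qed

theorem theorem2p9:
  fixes R F :: "(unit monomial \<Rightarrow>\<^sub>0 'k::field) set"
  assumes "sn_submodule free_operad 3 R"
    and "F = sn_generated free_operad 3 (id_plus_13_V_tensor_V \<inter> R)"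
  shows "admits_nonsymmetric_version R \<longleftrightarrow>
    op_dim (quadratic_operad R) 3 = op_dim (quadratic_operad F) 3"
proof -
  interpret nonsym_setup R F
    using assms by unfold_locales
  interpret R: operad_quotient free_operad "quadratic_ideal R"
    by unfold_locales (rule quadratic_ideal_ideal[OF sn_submoduleD(1)[OF R]])
  let ?N = "quotient_operad (As_white_product R) (nonsym_ideal R)"
  have "x \<in> {Prec (), Succ ()}" for x :: "unit white"
    by (cases x) simp_all
  hence "finite (UNIV :: unit white set)"
    by (intro finite_subset[of UNIV "{Prec (), Succ ()}"]) auto
  \<comment> \<open>The free operad on \<open>\<prec>\<close> and \<open>\<succ>\<close> is
    finite-dimensional in arity 3, and this survives both quotients.\<close>
  hence N_fin: "op_fin_dim ?N 3"
    by (intro N.fin_dim_quotient) (simp add: As_white_product_eq W.fin_dim_quotient op_fin_dim_free_3)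
  have F_fin: "op_fin_dim (quadratic_operad F) 3"
    unfolding quadratic_operad_def by (intro Q.fin_dim_quotient op_fin_dim_free_3) simp
  show ?thesis
  proof
    assume "admits_nonsymmetric_version R"
    hence "?N \<cong>\<^sub>o\<^sub>p quadratic_operad R"
      by (simp add: admits_nonsymmetric_version_def)
    \<comment> \<open>The isomorphism is arbitrary; only its arity 3 part is used, as a linear
      bijection.\<close>
    hence "op_dim ?N 3 = op_dim (quadratic_operad R) 3"
      using N.additive_quotient_operad R.additive_quotient_operad N_fin
      unfolding quadratic_operad_def[of R] by (rule operad_iso_op_dim_eq)
    moreover have "op_dim ?N 3 = op_dim (quadratic_operad F) 3"
      using nonsym_quotient_iso N.additive_quotient_operad additive_quadratic_operad N_fin
      by (rule operad_iso_op_dim_eq)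
    ultimately show "op_dim (quadratic_operad R) 3 = op_dim (quadratic_operad F) 3"
      by simp
  next
    assume "op_dim (quadratic_operad R) 3 = op_dim (quadratic_operad F) 3"
    hence "F = R"
      by (rule op_dim_quadratic_operad_eq_imp_eq[OF F_submodule R F_subset F_fin])
    thus "admits_nonsymmetric_version R"
      using nonsym_quotient_iso by (simp add: admits_nonsymmetric_version_def)
  qed
qed

end
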